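(* Let $G$ be a parity game with $n$ vertices, $m$ edges and $d$ different priorities. The algorithm $\textsc{Solve}$ described below computes the winning partition $(W_\Diamond,W_\square)$ of $G$ together with a winning strategy for player $\Diamond$ on $W_\Diamond$ and a winning strategy for player $\square$ on $W_\square$, in worst-case time $O\big(dm\cdot (n/\lfloor d/2\rfloor)^{\lfloor d/2\rfloor}\big)$.
   Context: A parity game $G=(V,E,\mathcal{P},(V_\Diamond,V_\square))$ consists of a finite set $V$ of vertices partitioned into $V_\Diamond$ (owned by player even, $\Diamond$) and $V_\square$ (owned by player odd, $\square$), a total edge relation $E\subseteq V\times V$, and a priority function $\mathcal{P}:V\to\mathbb{N}$. Write $v^\bullet=\{w\mid(v,w)\in E\}$, $V_i=\{v\mid\mathcal{P}(v)=i\}$, $V_{\geq k}=\{v\mid\mathcal{P}(v)\ge k\}$. In a play, $\Diamond$ wins iff the least priority occurring infinitely often is even; $W_\Diamond,W_\square$ are the sets of vertices from which the respective player has a winning strategy. Measures: let $D$ be one more than the largest priority. $\mathbb{M}^\Diamond$ consists of a top element $\top$ and all $D$-tuples with $0$ at even positions and a value $\le|V_i|$ at each odd position $i$, ordered lexicographically with every tuple $<\top$; $\alpha<_i\beta$ compares positions $0,\dots,i$ only. For $\rho:V\to\mathbb{M}^\Diamond$, $w\in v^\bullet$: $\mathrm{Prog}(\rho,v,w)$ is the least $m\in\mathbb{M}^\Diamond$ with $m\geq_{\mathcal{P}(v)}\rho(w)$ if $\mathcal{P}(v)$ is even, and $m>_{\mathcal{P}(v)}\rho(w)$ or $m=\rho(w)=\top$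 if $\mathcal{P}(v)$ is odd. $\mathrm{Lift}(\rho,v)$ replaces $\rho(v)$ by $\max\{\rho(v),\min_{w\in v^\bullet}\mathrm{Prog}(\rho,v,w)\}$ if $v\in V_\Diamond$ and by $\max\{\rho(v),\max_{w\in v^\bullet}\mathrm{Prog}(\rho,v,w)\}$ if $v\in V_\square$; $\sqsubseteq$ is the pointwise order, $\sqsubset$ its strict version. Attractors within $W\subseteq V$: $\mathrm{Attr}_{p,W}(U)$ (for player $p$, $U\subseteq W$) is the least $A\subseteq W$ containing $U$ such that a vertex of $W$ owned by $p$ with a successor in $A$ is in $A$, and a vertex of $W$ owned by the opponent all of whose successors in $W$ lie in $A$ is in $A$. The guarded attractor $\mathrm{Attr}^{\ge k}_{\square,W}(U)$ (for $U\subseteq W\cap V_{\ge k}$) is defined the same way for $\square$ but restricted to $A\subseteq W\cap V_{\geq k}$. "Attracting strategy" means the positional strategy forcing plays into the target within the attractor. Algorithm $\textsc{Solve}(G)$: initialise $\sigma$ empty and $\rho=\lambda w.(0,\dots,0)$; call $\textsf{SPM-Within}(V)$; set $\sigma'(v)$, for $v\in V_\Diamond$ with $\rho(v)\ne\top$, to a successor with minimal $\rho$-value; return $((\{v\mid\rho(v)\ne\top\},\sigma'),(\{v\mid\rho(v)=\top\},\sigma))$. Procedure $\textsf{SPM-Within}(W)$: while $W\neq\emptyset$: (i) while some $w\in W$ has $\rho\sqsubset\mathrm{Lift}(\rho,w)$ and no $w\in W$ has $\rho(w)=\top$, set $\rho\gets\mathrm{Lift}(\rho,w)$ for such a $w\in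 W$; (ii) if no $w\in W$ has $\rho(w)=\top$, stop; (iii) let $v$ be the unique $w\in W$ with $\rho(w)=\top$, $k=\mathcal{P}(v)$; set $\sigma(v)\gets u$ for some $u\in v^\bullet\cap W$ with $\rho(u')\le_k\rho(u)$ for all $u'\in v^\bullet\cap W$; (iv) $\mathrm{RES}\gets\mathrm{Attr}^{\ge k}_{\square,W}(\{v\})$; for all $w\in\mathrm{RES}\setminus\{v\}$ set $\rho(w)\gets\top$ and, if $w\in V_\square$, set $\sigma(w)$ to the strategy attracting to $v$; (v) $\mathrm{DOM}\gets\mathrm{RES}$; $\mathrm{IRR}\gets\mathrm{Attr}_{\Diamond,W}(\{w\in W\mid\mathcal{P}(w)<k\})$; $\mathrm{REM}\gets W\setminus(\mathrm{RES}\cup\mathrm{IRR})$; call $\textsf{SPM-Within}(\mathrm{REM})$; $\mathrm{DOM}\gets\mathrm{DOM}\cup\{w\in\mathrm{REM}\mid\rho(w)=\top\}$; (vi) $A\gets\mathrm{Attr}_{\square,W}(\mathrm{DOM})$; for all $w\in A\setminus\mathrm{DOM}$ set $\rho(w)\gets\top$ and, if $w\in V_\square$, set $\sigma(w)$ to the strategy attracting to $\mathrm{DOM}$; (vii) $W\gets W\setminus A$.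
   Formalization: The time bound (only) is stated for games in which at most as many odd as even priorities occur, as when the priorities are 0,…,d−1; without this it fails, e.g. on an n-cycle of priority 1. The O-constant is uniform over games on one vertex type; time is a step-cost count. *)

theory Defs
  imports Complex_Main "HOL-Library.List_Lexorder"
begin

section \<open>Parity games\<close>

datatype player = Diamond | Square

primrec opponent :: "player \<Rightarrow> player" where
  "opponent Diamond = Square"
| "opponent Square = Diamond"

record 'v game =
  verts :: "'v set"
  edges :: "('v \<times> 'v) set"
  prio :: "'v \<Rightarrow> nat"
  owned :: "player \<Rightarrow> 'v set"

definition parity_game :: "'v game \<Rightarrow> bool" where
  "parity_game G \<longleftrightarrow>
     finite (verts G) \<and>
     owned G Diamond \<union> owned G Square = verts G \<and>
     owned G Diamond \<inter> owned G Square = {} \<and>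
     edges G \<subseteq> verts G \<times> verts G \<and>
     (\<forall>v\<in>verts G. \<exists>w. (v, w) \<in> edges G)"

definition succs :: "'v game \<Rightarrow> 'v \<Rightarrow> 'v set" where
  "succs G v = {w. (v, w) \<in> edges G}"

definition preds :: "'v game \<Rightarrow> 'v \<Rightarrow> 'v set" where
  "preds G v = {u. (u, v) \<in> edges G}"

definition num_prios :: "'v game \<Rightarrow> nat" where
  "num_prios G = card (prio G ` verts G)"

definition play :: "'v game \<Rightarrow> 'v \<Rightarrow> (nat \<Rightarrow> 'v) \<Rightarrow> bool" where
  "play G v \<pi> \<longleftrightarrow> \<pi> 0 = v \<and> (\<forall>i. (\<pi> i, \<pi> (Suc i)) \<in> edges G)"

primrec won_by :: "'v game \<Rightarrow> player \<Rightarrow> (nat \<Rightarrow> 'v) \<Rightarrow> bool" where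
  "won_by G Diamond \<pi> \<longleftrightarrow> even (LEAST k. infinite {i. prio G (\<pi> i) = k})"
| "won_by G Square \<pi> \<longleftrightarrow> odd (LEAST k. infinite {i. prio G (\<pi> i) = k})"

text \<open>
  A strategy is a partial function on histories. Only its values on histories that end in a vertex
  of the player in question matter, and where it is undefined the player may move arbitrarily.
\<close>

definition strategy :: "'v game \<Rightarrow> player \<Rightarrow> ('v list \<Rightarrow> 'v option) \<Rightarrow> bool" where
  "strategy G p f \<longleftrightarrow>
     (\<forall>h v w. v \<in> owned G p \<longrightarrow> f (h @ [v]) = Some w \<longrightarrow> (v, w) \<in> edges G)"

definition consistent :: "'v game \<Rightarrow> player \<Rightarrow> ('v list \<Rightarrow> 'v option) \<Rightarrow> (nat \<Rightarrow> 'v) \<Rightarrow> bool" where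
  "consistent G p f \<pi> \<longleftrightarrow>
     (\<forall>i w. \<pi> i \<in> owned G p \<longrightarrow> f (map \<pi> [0..<Suc i]) = Some w \<longrightarrow> \<pi> (Suc i) = w)"

definition winning_from :: "'v game \<Rightarrow> player \<Rightarrow> ('v list \<Rightarrow> 'v option) \<Rightarrow> 'v \<Rightarrow> bool" where
  "winning_from G p f v \<longleftrightarrow>
     strategy G p f \<and> (\<forall>\<pi>. play G v \<pi> \<and> consistent G p f \<pi> \<longrightarrow> won_by G p \<pi>)"

definition winning_region :: "'v game \<Rightarrow> player \<Rightarrow> 'v set" where
  "winning_region G p = {v \<in> verts G. \<exists>f. winning_from G p f v}"

definition positional :: "('v \<Rightarrow> 'v option) \<Rightarrow> 'v list \<Rightarrow> 'v option" where
  "positional \<sigma> h = \<sigma> (last h)"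

definition winning_strategy_on :: "'v game \<Rightarrow> player \<Rightarrow> 'v set \<Rightarrow> ('v \<Rightarrow> 'v option) \<Rightarrow> bool" where
  "winning_strategy_on G p U \<sigma> \<longleftrightarrow>
     U \<inter> owned G p \<subseteq> dom \<sigma> \<and> (\<forall>v\<in>U. winning_from G p (positional \<sigma>) v)"


section \<open>Measures\<close>

datatype measure = Tuple "nat list" | Top

instantiation measure :: linorder
begin

definition less_eq_measure :: "measure \<Rightarrow> measure \<Rightarrow> bool" where
  "\<alpha> \<le> \<beta> \<longleftrightarrow>
     (case \<beta> of Top \<Rightarrow> True | Tuple b \<Rightarrow> (case \<alpha> of Top \<Rightarrow> False | Tuple a \<Rightarrow> a \<le> b))"

definition less_measure :: "measure \<Rightarrow> measure \<Rightarrow> bool" where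
  "\<alpha> < \<beta> \<longleftrightarrow> \<alpha> \<le> \<beta> \<and> \<not> \<beta> \<le> (\<alpha> :: measure)"

instance
  by standard (auto simp: less_eq_measure_def less_measure_def split: measure.splits)

end

text \<open>
  \<open>\<alpha> <\<^sub>i \<beta>\<close> is \<open>trunc i \<alpha> < trunc i \<beta>\<close>; on lists of equal length the order is lexicographic.
\<close>

primrec trunc :: "nat \<Rightarrow> measure \<Rightarrow> measure" where
  "trunc i (Tuple a) = Tuple (take (Suc i) a)"
| "trunc i Top = Top"

definition dimension :: "'v game \<Rightarrow> nat" where
  "dimension G = Suc (Max (prio G ` verts G))"

definition measures :: "'v game \<Rightarrow> measure set" where
  "measures G = insert Top
     {Tuple a | a. length a = dimension G \<and>
        (\<forall>i<dimension G. a ! i \<le> (if odd i then card {v \<in> verts G. prio G v = i} else 0))}"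

definition prog :: "'v game \<Rightarrow> ('v \<Rightarrow> measure) \<Rightarrow> 'v \<Rightarrow> 'v \<Rightarrow> measure" where
  "prog G \<rho> v w =
     (if even (prio G v)
      then LEAST m. m \<in> measures G \<and> trunc (prio G v) m \<ge> trunc (prio G v) (\<rho> w)
      else LEAST m. m \<in> measures G \<and>
             (trunc (prio G v) m > trunc (prio G v) (\<rho> w) \<or> m = \<rho> w \<and> \<rho> w = Top))"

definition lift :: "'v game \<Rightarrow> ('v \<Rightarrow> measure) \<Rightarrow> 'v \<Rightarrow> ('v \<Rightarrow> measure)" where
  "lift G \<rho> v = \<rho>(v := max (\<rho> v)
     (if v \<in> owned G Diamond then Min (prog G \<rho> v ` succs G v) else Max (prog G \<rho> v ` succs G v)))"


section \<open>Attractors\<close>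

text \<open>
  \<open>attr G p W S U\<close> is the attractor to \<open>U\<close> for \<open>p\<close> in the subgame on \<open>W\<close>, restricted to \<open>S \<subseteq> W\<close>:
  \<open>S = W\<close> gives the ordinary attractor within \<open>W\<close>, \<open>S = W \<inter> V\<^bsub>\<ge>k\<^esub>\<close> the guarded one. The opponent's
  escapes range over \<open>W\<close>, not just over \<open>S\<close>.
\<close>

inductive_set attr :: "'v game \<Rightarrow> player \<Rightarrow> 'v set \<Rightarrow> 'v set \<Rightarrow> 'v set \<Rightarrow> 'v set"
  for G :: "'v game" and p :: player and W S U :: "'v set" where
  target: "v \<in> U \<Longrightarrow> v \<in> attr G p W S U"
| own: "v \<in> S \<Longrightarrow> v \<in> owned G p \<Longrightarrow> w \<in> succs G v \<Longrightarrow> w \<in> attr G p W S U \<Longrightarrow>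
    v \<in> attr G p W S U"
| opp: "v \<in> S \<Longrightarrow> v \<in> owned G (opponent p) \<Longrightarrow>
    (\<And>w. w \<in> succs G v \<inter> W \<Longrightarrow> w \<in> attr G p W S U) \<Longrightarrow> v \<in> attr G p W S U"

abbreviation attractor :: "'v game \<Rightarrow> player \<Rightarrow> 'v set \<Rightarrow> 'v set \<Rightarrow> 'v set" where
  "attractor G p W U \<equiv> attr G p W W U"

abbreviation guarded_attractor :: "'v game \<Rightarrow> nat \<Rightarrow> 'v set \<Rightarrow> 'v set \<Rightarrow> 'v set" where
  "guarded_attractor G k W U \<equiv> attr G Square W {v \<in> W. prio G v \<ge> k} U"

definition attracting :: "'v game \<Rightarrow> player \<Rightarrow> 'v set \<Rightarrow> 'v set \<Rightarrow> 'v set \<Rightarrow> ('v \<Rightarrow> 'v) \<Rightarrow> bool" where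
  "attracting G p W A U \<tau> \<longleftrightarrow>
     (\<forall>v \<in> (A - U) \<inter> owned G p. \<tau> v \<in> succs G v \<inter> A) \<and>
     (\<forall>\<pi>. \<pi> 0 \<in> A \<and> (\<forall>i. \<pi> i \<in> W \<and> \<pi> (Suc i) \<in> succs G (\<pi> i)) \<and>
          (\<forall>i. \<pi> i \<in> (A - U) \<inter> owned G p \<longrightarrow> \<pi> (Suc i) = \<tau> (\<pi> i)) \<longrightarrow>
          (\<exists>i. \<pi> i \<in> U \<and> (\<forall>j\<le>i. \<pi> j \<in> A)))"

definition set_top :: "'v set \<Rightarrow> ('v \<Rightarrow> measure) \<Rightarrow> ('v \<Rightarrow> measure)" where
  "set_top X \<rho> = (\<lambda>w. if w \<in> X then Top else \<rho> w)"

definition record_moves :: "'v set \<Rightarrow> ('v \<Rightarrow> 'v) \<Rightarrow> ('v \<Rightarrow> 'v option) \<Rightarrow> ('v \<Rightarrow> 'v option)" where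
  "record_moves X \<tau> \<sigma> = (\<lambda>w. if w \<in> X then Some (\<tau> w) else \<sigma> w)"


section \<open>The algorithm\<close>

text \<open>
  The algorithm is a nondeterministic transition system over the global variables \<open>\<sigma>\<close>, \<open>\<rho>\<close> and a
  call stack. \<open>Within W\<close> is an activation of SPM-Within at the head of its outer loop;
  \<open>Resume W RES REM\<close> is one waiting for the recursive call on \<open>REM\<close> to return. Every choice the
  pseudo-code leaves open (lifted vertex, successor \<open>u\<close>, attracting strategies, minimal successors)
  is a choice of transition.
\<close>

datatype 'v frame = Within "'v set" | Resume "'v set" "'v set" "'v set"

datatype 'v config =
    Start
  | Running "'v frame list" "'v \<Rightarrow> 'v option" "'v \<Rightarrow> measure"
  | Done "'v set \<times> ('v \<Rightarrow> 'v option)" "'v set \<times> ('v \<Rightarrow> 'v option)"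

text \<open>
  Costs count elementary operations up to a constant factor, with vertices and tuple entries as
  machine words.

  Operating on one tuple costs \<open>num_prios G\<close>: the positions \<open>i\<close> for which no vertex has priority \<open>i\<close>
  are \<open>0\<close> in every measure and are not stored. If the priorities are \<open>0, \<dots>, d - 1\<close> this is the
  full length of the tuple.

  Lifting \<open>w\<close> costs one tuple operation per edge at \<open>w\<close>: the outgoing edges to evaluate \<open>prog\<close>, the
  incoming ones to keep the set of liftable vertices up to date (a counter at each \<open>\<Diamond>\<close>-vertex of the
  successors that do not force a lift, a flag at each \<open>\<box>\<close>-vertex), from which the next vertex to lift
  is taken in constant time.

  Every other step is charged one tuple operation per edge of the game. This covers a constant number
  of linear-time attractor computations, the traversal of the vertex sets (by totality there are no
  more vertices than edges), and setting up the set of liftable vertices for the loop entered next.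
\<close>

definition lift_cost :: "'v game \<Rightarrow> 'v \<Rightarrow> nat" where
  "lift_cost G w = num_prios G * (card (succs G w) + card (preds G w))"

definition scan_cost :: "'v game \<Rightarrow> nat" where
  "scan_cost G = num_prios G * card (edges G)"

text \<open>
  Rule \<open>leave\<close> also covers leaving the outer loop because \<open>W\<close> is empty. The second premise of \<open>top\<close>
  is the uniqueness of the vertex with measure \<open>Top\<close>; if it were violated, the execution would get stuck.
\<close>

inductive step :: "'v game \<Rightarrow> 'v config \<Rightarrow> nat \<Rightarrow> 'v config \<Rightarrow> bool"
  for G :: "'v game" where
  init: "step G Start (scan_cost G)
     (Running [Within (verts G)] Map.empty (\<lambda>w. Tuple (replicate (dimension G) 0)))"
| lift: "w \<in> W \<Longrightarrow> \<rho> < lift G \<rho> w \<Longrightarrow> (\<forall>w'\<in>W. \<rho> w' \<noteq> Top) \<Longrightarrow>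
     step G (Running (Within W # fs) \<sigma> \<rho>) (lift_cost G w)
       (Running (Within W # fs) \<sigma> (lift G \<rho> w))"
| leave: "(\<forall>w\<in>W. \<not> \<rho> < lift G \<rho> w) \<Longrightarrow> (\<forall>w\<in>W. \<rho> w \<noteq> Top) \<Longrightarrow>
     step G (Running (Within W # fs) \<sigma> \<rho>) (scan_cost G) (Running fs \<sigma> \<rho>)"
| top: "v \<in> W \<Longrightarrow> (\<forall>w\<in>W. \<rho> w = Top \<longleftrightarrow> w = v) \<Longrightarrow> k = prio G v \<Longrightarrow>
     u \<in> succs G v \<inter> W \<Longrightarrow> (\<forall>u'\<in>succs G v \<inter> W. trunc k (\<rho> u') \<le> trunc k (\<rho> u)) \<Longrightarrow>
     RES = guarded_attractor G k W {v} \<Longrightarrow> attracting G Square W RES {v} \<tau> \<Longrightarrow>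
     IRR = attractor G Diamond W {w \<in> W. prio G w < k} \<Longrightarrow>
     REM = W - (RES \<union> IRR) \<Longrightarrow>
     step G (Running (Within W # fs) \<sigma> \<rho>) (scan_cost G)
       (Running (Within REM # Resume W RES REM # fs)
          (record_moves ((RES - {v}) \<inter> owned G Square) \<tau> (\<sigma>(v \<mapsto> u)))
          (set_top (RES - {v}) \<rho>))"
| resume: "DOM = RES \<union> {w \<in> REM. \<rho> w = Top} \<Longrightarrow>
     A = attractor G Square W DOM \<Longrightarrow> attracting G Square W A DOM \<tau> \<Longrightarrow>
     step G (Running (Resume W RES REM # fs) \<sigma> \<rho>) (scan_cost G)
       (Running (Within (W - A) # fs)
          (record_moves ((A - DOM) \<inter> owned G Square) \<tau> \<sigma>)
          (set_top (A - DOM) \<rho>))"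
| finish: "dom \<sigma>' = {v \<in> owned G Diamond. \<rho> v \<noteq> Top} \<Longrightarrow>
     (\<forall>v u. \<sigma>' v = Some u \<longrightarrow> u \<in> succs G v \<and> (\<forall>w\<in>succs G v. \<rho> u \<le> \<rho> w)) \<Longrightarrow>
     step G (Running [] \<sigma> \<rho>) (scan_cost G)
       (Done ({v \<in> verts G. \<rho> v \<noteq> Top}, \<sigma>') ({v \<in> verts G. \<rho> v = Top}, \<sigma>))"

text \<open>\<open>steps G c t c'\<close>: some finite execution from \<open>c\<close> to \<open>c'\<close> has total cost \<open>t\<close>.\<close>

inductive steps :: "'v game \<Rightarrow> 'v config \<Rightarrow> nat \<Rightarrow> 'v config \<Rightarrow> bool"
  for G :: "'v game" and c :: "'v config" where
  refl: "steps G c 0 c"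
| step: "steps G c t c' \<Longrightarrow> step G c' s c'' \<Longrightarrow> steps G c (t + s) c''"

definition solve_terminates :: "'v game \<Rightarrow> bool" where
  "solve_terminates G \<longleftrightarrow>
     \<not> (\<exists>cs. cs 0 = Start \<and> (\<forall>i::nat. \<exists>s. step G (cs i) s (cs (Suc i))))"

text \<open>Maximal finite executions; in particular none of them is stuck before reaching \<open>Done\<close>.\<close>

definition solve_correct :: "'v game \<Rightarrow> bool" where
  "solve_correct G \<longleftrightarrow>
     (\<forall>t c. steps G Start t c \<and> \<not> (\<exists>s c'. step G c s c') \<longrightarrow>
        (\<exists>\<sigma>\<^sub>D \<sigma>\<^sub>S.
           c = Done (winning_region G Diamond, \<sigma>\<^sub>D) (winning_region G Square, \<sigma>\<^sub>S) \<and>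
           winning_strategy_on G Diamond (winning_region G Diamond) \<sigma>\<^sub>D \<and>
           winning_strategy_on G Square (winning_region G Square) \<sigma>\<^sub>S))"

definition solve_time_le :: "'v game \<Rightarrow> real \<Rightarrow> bool" where
  "solve_time_le G b \<longleftrightarrow> (\<forall>t c. steps G Start t c \<longrightarrow> real t \<le> b)"

end

theory Submission
  imports Defs "HOL-Analysis.Convex"
begin

text \<open>
  Every change of \<open>\<rho>\<close> is a sequence of liftings, so \<open>\<rho>\<close> stays below every progress measure, and at the
  end it is one; this gives \<open>\<Diamond>\<close>'s half. What has to be shown is that \<open>\<sigma>\<close> wins for \<open>\<box>\<close>, and the
  crucial point is that the vertex \<open>u\<close> chosen at a vertex \<open>v\<close> that has just become \<open>Top\<close> ends up in \<open>DOM\<close>.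
  The truncation of \<open>\<rho> u\<close> to the positions up to \<open>k\<close>, the priority of \<open>v\<close>, is the largest possible one.
  This is refuted for \<open>u \<in> IRR\<close> and for \<open>u \<in> REM\<close> not lost to \<open>\<Diamond>\<close>, by exhibiting bounds on \<open>\<rho>\<close> there
  in which position \<open>i\<close> counts only vertices of priority \<open>i\<close> met on the way: \<open>v\<close> itself is never
  counted, so position \<open>k\<close> stays below its maximum. In nested calls the same count bounds \<open>\<rho>\<close> at the
  vertices outside \<open>W\<close> to which \<open>\<box>\<close> can escape.

  Hence a play consistent with \<open>\<sigma>\<close> that stays in \<open>DOM\<close> either remains in the part solved recursively or
  visits \<open>v\<close> infinitely often without ever seeing a priority below \<open>k\<close>.

  For the running time, each vertex is lifted at most once per tuple, and the number of tuples is bounded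
  by the inequality of the means, using that each even priority also needs a vertex.
\<close>

section \<open>Measures\<close>

lemma list_le_pointwise:
  fixes a b :: "'a::linorder list"
  assumes "length a = length b" "\<And>i. i < length a \<Longrightarrow> a ! i \<le> b ! i"
  shows "a \<le> b"
  using assms
proof (induction a b rule: list_induct2)
  case (Cons x xs y ys)
  then have "x \<le> y" "xs \<le> ys" by fastforce+
  then show ?case by auto
qed simp

lemma list_take_mono:
  fixes a b :: "'a::linorder list"
  shows "a \<le> b \<Longrightarrow> take n a \<le> take n b"
proof (induction n arbitrary: a b)
  case (Suc n)
  then show ?case by (cases a; cases b) auto
qed simp

lemma list_less_pointwise:
  fixes a b :: "'a::linorder list"
  assumes "length a = length b" "\<And>i. i < length a \<Longrightarrow> a ! i \<le> b ! i"
    and "i < length a" "a ! i < b ! i"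
  shows "a < b"
  using list_le_pointwise[OF assms(1,2)] assms(4) by (auto simp: order.strict_iff_order)

lemma measure_le_simps [simp]:
  "\<alpha> \<le> Top" "Top \<le> \<alpha> \<longleftrightarrow> \<alpha> = Top" "Tuple a \<le> Tuple b \<longleftrightarrow> a \<le> b"
  "Tuple a < Tuple b \<longleftrightarrow> a < b" "Tuple a < Top" "\<not> Top < \<alpha>"
  by (cases \<alpha>; auto simp: less_eq_measure_def less_measure_def)+

lemma less_Top_iff [simp]: "\<alpha> < Top \<longleftrightarrow> \<alpha> \<noteq> Top"
  by (cases \<alpha>) auto

lemma trunc_eq_Top_iff [simp]: "trunc i \<alpha> = Top \<longleftrightarrow> \<alpha> = Top"
  by (cases \<alpha>) auto

lemma trunc_mono: "\<alpha> \<le> \<beta> \<Longrightarrow> trunc i \<alpha> \<le> trunc i \<beta>"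
  by (cases \<alpha>; cases \<beta>) (auto simp: list_take_mono)

lemma trunc_trunc: "i \<le> j \<Longrightarrow> trunc i (trunc j \<alpha>) = trunc i \<alpha>"
  by (cases \<alpha>) (auto simp: min_def)

lemma trunc_mono_le: "i \<le> j \<Longrightarrow> trunc j \<alpha> \<le> trunc j \<beta> \<Longrightarrow> trunc i \<alpha> \<le> trunc i \<beta>"
  by (metis trunc_mono trunc_trunc)

text \<open>The condition on \<open>m\<close> whose least solution is \<open>prog\<close> for a
  successor of value \<open>n\<close>. It reads only positions up to \<open>p\<close>.\<close>

definition above :: "nat \<Rightarrow> measure \<Rightarrow> measure \<Rightarrow> bool" where
  "above p m n \<longleftrightarrow>
     (if even p then trunc p n \<le> trunc p m else trunc p n < trunc p m \<or> m = Top \<and> n = Top)"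

lemma above_Top [simp]: "above p Top n"
  by (auto simp: above_def)

lemma above_mono:
  assumes "above p m n" "trunc p m \<le> trunc p m'" "trunc p n' \<le> trunc p n"
  shows "above p m' n'"
  using assms by (force simp: above_def split: if_splits)

lemma above_trunc_le: "above p m n \<Longrightarrow> trunc p n \<le> trunc p m"
  by (auto simp: above_def split: if_splits)

lemma above_not_Top: "above p m n \<Longrightarrow> m \<noteq> Top \<Longrightarrow> n \<noteq> Top"
  using above_trunc_le by fastforce

lemma bounded_lists_finite_card:
  "finite {a :: nat list. length a = length bs \<and> (\<forall>i<length bs. a ! i \<le> bs ! i)} \<and>
   card {a :: nat list. length a = length bs \<and> (\<forall>i<length bs. a ! i \<le> bs ! i)}
     = (\<Prod>i<length bs. bs ! i + 1)"
proof (induction bs)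
  case (Cons b bs)
  let ?L = "\<lambda>bs. {a :: nat list. length a = length bs \<and> (\<forall>i<length bs. a ! i \<le> bs ! i)}"
  have eq: "?L (b # bs) = (\<lambda>(x, a). x # a) ` ({..b} \<times> ?L bs)"
  proof (intro set_eqI iffI)
    fix a assume "a \<in> ?L (b # bs)"
    then obtain x a' where "a = x # a'" "length a' = length bs" "x \<le> b" "\<forall>i<length bs. a' ! i \<le> bs ! i"
      by (cases a) fastforce+
    then show "a \<in> (\<lambda>(x, a). x # a) ` ({..b} \<times> ?L bs)"
      by auto
  next
    fix a assume "a \<in> (\<lambda>(x, a). x # a) ` ({..b} \<times> ?L bs)"
    then show "a \<in> ?L (b # bs)"
      by (auto simp: nth_Cons split: nat.splits)
  qed
  have "inj_on (\<lambda>(x, a). x # a) ({..b} \<times> ?L bs)"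
    by (auto simp: inj_on_def)
  then have "card (?L (b # bs)) = (b + 1) * card (?L bs)"
    unfolding eq by (subst card_image) (auto simp: card_cartesian_product)
  moreover have "(\<Prod>i<length (b # bs). (b # bs) ! i + 1) = (b + 1) * (\<Prod>i<length bs. bs ! i + 1)"
    by (simp add: prod.lessThan_Suc_shift del: prod.lessThan_Suc)
  moreover have "finite (?L (b # bs))"
    unfolding eq using Cons by auto
  ultimately show ?case using Cons by simp
qed simp

section \<open>Capacities and the finite set of measures\<close>

locale parity =
  fixes G :: "'v game"
  assumes pg: "parity_game G"
begin

abbreviation "V \<equiv> verts G"
abbreviation "P \<equiv> prio G"
abbreviation "VD \<equiv> owned G Diamond"
abbreviation "VS \<equiv> owned G Square"
abbreviation "M \<equiv> measures G"
abbreviation "len \<equiv> Defs.dimension G"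

lemma fin_V [simp]: "finite V"
  and owned_Un: "VD \<union> VS = V"
  and owned_disj: "VD \<inter> VS = {}"
  and succs_sub: "succs G v \<subseteq> V"
  using pg by (auto simp: parity_game_def succs_def)

lemma succs_nonempty: "v \<in> V \<Longrightarrow> succs G v \<noteq> {}"
  using pg by (auto simp: parity_game_def succs_def)

lemma fin_succs [simp]: "finite (succs G v)"
  using succs_sub fin_V by (rule finite_subset)

lemma Square_iff: "v \<in> V \<Longrightarrow> v \<in> VS \<longleftrightarrow> v \<notin> VD"
  using owned_Un owned_disj by auto

lemma ownedD: "v \<in> VD \<Longrightarrow> v \<in> V" "v \<in> VS \<Longrightarrow> v \<in> V"
  using owned_Un by auto

lemma prio_less_dim: "v \<in> V \<Longrightarrow> P v < len"
  by (simp add: Defs.dimension_def less_Suc_eq_le)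

definition cap :: "nat \<Rightarrow> nat" where
  "cap i = card {v \<in> V. P v = i}"

text \<open>Even positions are zeroed here, so that counting functions can be compared at all
  positions without regard to parity.\<close>

definition tup :: "(nat \<Rightarrow> nat) \<Rightarrow> measure" where
  "tup f = Tuple (map (\<lambda>i. if odd i then f i else 0) [0..<len])"

lemma tup_not_Top [simp]: "tup f \<noteq> Top"
  by (simp add: tup_def)

lemma tup_in: "(\<And>i. f i \<le> cap i) \<Longrightarrow> tup f \<in> M"
  by (auto simp: tup_def measures_def cap_def)

lemma Top_in [simp]: "Top \<in> M"
  by (simp add: measures_def)

lemma measures_eq:
  "M = insert Top (Tuple ` {a. length a = len \<and> (\<forall>i<len. a ! i \<le> (if odd i then cap i else 0))})"
  by (auto simp: measures_def cap_def)

lemma fin_M [simp]: "finite M"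
  and card_M_le: "card M \<le> Suc (\<Prod>i<len. (if odd i then cap i else 0) + 1)"
proof -
  let ?L = "{a. length a = len \<and> (\<forall>i<len. a ! i \<le> (if odd i then cap i else 0))}"
  let ?bs = "map (\<lambda>i. if odd i then cap i else 0) [0..<len]"
  have L: "{a. length a = length ?bs \<and> (\<forall>i<length ?bs. a ! i \<le> ?bs ! i)} = ?L"
    by auto
  have p: "(\<Prod>i<length ?bs. ?bs ! i + 1) = (\<Prod>i<len. (if odd i then cap i else 0) + 1)"
    by (intro prod.cong) auto
  have "finite ?L" and c: "card ?L = (\<Prod>i<len. (if odd i then cap i else 0) + 1)"
    using bounded_lists_finite_card[of ?bs] unfolding L p by blast+
  then show "finite M" by (simp add: measures_eq)
  have "card (Tuple ` ?L) \<le> card ?L"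
    using \<open>finite ?L\<close> by (rule card_image_le)
  then show "card M \<le> Suc (\<Prod>i<len. (if odd i then cap i else 0) + 1)"
    unfolding measures_eq c[symmetric] using \<open>finite ?L\<close>
    by (subst card_insert_disjoint) auto
qed

lemma tup_trunc_mono:
  assumes "\<And>i. i \<le> p \<Longrightarrow> f i \<le> g i"
  shows "trunc p (tup f) \<le> trunc p (tup g)"
  unfolding tup_def using assms
  by (auto intro!: list_le_pointwise simp del: upt_Suc)

lemma tup_mono: "(\<And>i. f i \<le> g i) \<Longrightarrow> tup f \<le> tup g"
  unfolding tup_def by (auto intro!: list_le_pointwise simp del: upt_Suc)

lemma tup_trunc_less:
  assumes "\<And>i. i \<le> p \<Longrightarrow> f i \<le> g i" "odd p" "p < len" "f p < g p"
  shows "trunc p (tup f) < trunc p (tup g)"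
  unfolding tup_def using assms
  by (auto intro!: list_less_pointwise[where i = p] simp del: upt_Suc)

text \<open>The criterion by which counts yield progress: on the way to a successor the counts up to
  position \<open>p\<close> must not grow, and for odd \<open>p\<close> the count at
  \<open>p\<close> must drop.\<close>

lemma above_tup:
  assumes "\<And>i. i \<le> p \<Longrightarrow> f i \<le> g i" "odd p \<Longrightarrow> p < len \<and> f p < g p"
  shows "above p (tup g) (tup f)"
  using assms tup_trunc_mono[of p f g] tup_trunc_less[of p f g] by (auto simp: above_def)

lemma trunc_le_tup_cap:
  assumes "m \<in> M" "m \<noteq> Top" "\<And>i. i \<le> p \<Longrightarrow> odd i \<Longrightarrow> cap i \<le> f i"
  shows "trunc p m \<le> trunc p (tup f)"
proof -
  obtain a where a: "m = Tuple a" "length a = len"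
    and le: "\<And>i. i < len \<Longrightarrow> a ! i \<le> (if odd i then cap i else 0)"
    using assms(1,2) by (auto simp: measures_eq)
  have "take (Suc p) a \<le> take (Suc p) (map (\<lambda>i. if odd i then f i else 0) [0..<len])"
  proof (rule list_le_pointwise)
    fix i assume "i < length (take (Suc p) a)"
    then have "i \<le> p" "i < len" using a by auto
    then show "take (Suc p) a ! i \<le> take (Suc p) (map (\<lambda>i. if odd i then f i else 0) [0..<len]) ! i"
      using le[of i] assms(3)[of i] by (auto split: if_splits simp del: upt_Suc)
  qed (simp add: a)
  then show ?thesis
    by (simp add: tup_def a)
qed

lemma zero_le: "m \<in> M \<Longrightarrow> Tuple (replicate len 0) \<le> m"
  by (auto simp: measures_def intro!: list_le_pointwise)

lemma zero_in: "Tuple (replicate len 0) \<in> M"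
  by (auto simp: measures_def)

section \<open>Progress along a single edge\<close>

lemma prog_eq: "prog G \<rho> v w = (LEAST m. m \<in> M \<and> above (P v) m (\<rho> w))"
  unfolding prog_def above_def by (cases "even (P v)") (auto intro!: arg_cong[where f = Least])

lemma prog_props:
  shows prog_in: "prog G \<rho> v w \<in> M"
    and prog_above: "above (P v) (prog G \<rho> v w) (\<rho> w)"
    and prog_le: "m \<in> M \<Longrightarrow> above (P v) m (\<rho> w) \<Longrightarrow> prog G \<rho> v w \<le> m"
proof -
  let ?A = "{m. m \<in> M \<and> above (P v) m (\<rho> w)}"
  have A: "finite ?A" "?A \<noteq> {}" using above_Top Top_in by (auto simp del: Top_in above_Top)
  have "prog G \<rho> v w = Min ?A"
    unfolding prog_eq by (rule Least_Min) (use A in auto)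
  then show "prog G \<rho> v w \<in> M" "above (P v) (prog G \<rho> v w) (\<rho> w)"
    "m \<in> M \<Longrightarrow> above (P v) m (\<rho> w) \<Longrightarrow> prog G \<rho> v w \<le> m"
    using Min_in[OF A] Min_le[OF A(1)] by auto
qed

lemma prog_le_iff: "m \<in> M \<Longrightarrow> prog G \<rho> v w \<le> m \<longleftrightarrow> above (P v) m (\<rho> w)"
  using prog_le prog_above above_mono trunc_mono by blast

text \<open>Minimality of \<open>prog\<close> makes its values zero beyond position \<open>P v\<close>.\<close>

definition tight :: "nat \<Rightarrow> measure \<Rightarrow> bool" where
  "tight p m \<longleftrightarrow> (\<forall>m'\<in>M. trunc p m \<le> trunc p m' \<longrightarrow> m \<le> m')"

lemma tight_prog: "tight (P v) (prog G \<rho> v w)"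
  unfolding tight_def by (meson above_mono order_refl prog_above prog_le)

lemma tight_Top [simp]: "tight p Top"
  by (simp add: tight_def)

text \<open>For an even priority \<open>\<rho> w\<close> itself is admissible, and for an odd one
  the largest tuple \<open>tup cap\<close> is, unless \<open>\<rho> w\<close> already reaches it on
  the positions that count.\<close>

lemma prog_eq_Top:
  assumes "prog G \<rho> v w = Top" "\<rho> w \<in> M" "\<rho> w \<noteq> Top"
  shows "odd (P v)" "trunc (P v) (tup cap) \<le> trunc (P v) (\<rho> w)"
proof -
  have "above (P v) (\<rho> w) (\<rho> w)" if "even (P v)"
    using that by (simp add: above_def)
  then show o: "odd (P v)"
    using prog_le[OF assms(2)] assms by fastforce
  have "\<not> above (P v) (tup cap) (\<rho> w)"
    using prog_le[OF tup_in[of cap]] assms(1) by fastforce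
  then show "trunc (P v) (tup cap) \<le> trunc (P v) (\<rho> w)"
    using o by (auto simp: above_def)
qed

section \<open>Lifting and progress measures\<close>

definition up :: "('v \<Rightarrow> measure) \<Rightarrow> 'v \<Rightarrow> measure" where
  "up \<rho> v = (if v \<in> VD then Min (prog G \<rho> v ` succs G v) else Max (prog G \<rho> v ` succs G v))"

text \<open>The local progress condition, with the candidate \<open>m\<close> for \<open>v\<close>
  kept apart from the successor values in \<rho>. A progress measure satisfies
  \<open>sat_at \<rho> v (\<rho> v)\<close> at every vertex \<open>v\<close>.\<close>

definition sat_at :: "('v \<Rightarrow> measure) \<Rightarrow> 'v \<Rightarrow> measure \<Rightarrow> bool" where
  "sat_at \<rho> v m \<longleftrightarrow>
     (if v \<in> VD then \<exists>w\<in>succs G v. above (P v) m (\<rho> w) else \<forall>w\<in>succs G v. above (P v) m (\<rho> w))"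

lemma lift_eq: "lift G \<rho> v = \<rho>(v := max (\<rho> v) (up \<rho> v))"
  by (simp add: lift_def up_def)

lemma less_lift_iff: "\<rho> < lift G \<rho> v \<longleftrightarrow> \<not> up \<rho> v \<le> \<rho> v"
  by (auto simp: lift_eq less_fun_def le_fun_def max_def)

lemma up_le_iff:
  assumes "v \<in> V" "m \<in> M"
  shows "up \<rho> v \<le> m \<longleftrightarrow> sat_at \<rho> v m"
  using succs_nonempty[OF assms(1)] prog_le_iff[OF assms(2), of \<rho> v]
  by (auto simp: up_def sat_at_def Min_le_iff)

lemma le_up_iff:
  assumes "v \<in> V"
  shows "m \<le> up \<rho> v \<longleftrightarrow>
    (if v \<in> VD then \<forall>w\<in>succs G v. m \<le> prog G \<rho> v w else \<exists>w\<in>succs G v. m \<le> prog G \<rho> v w)"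
  using succs_nonempty[OF assms] by (auto simp: up_def Max_ge_iff)

lemma up_prog:
  assumes "v \<in> V"
  shows "\<exists>w\<in>succs G v. up \<rho> v = prog G \<rho> v w"
proof -
  have "up \<rho> v \<in> prog G \<rho> v ` succs G v"
    unfolding up_def using succs_nonempty[OF assms] by auto
  then show ?thesis by auto
qed

lemma up_in: "v \<in> V \<Longrightarrow> up \<rho> v \<in> M" and tight_up: "v \<in> V \<Longrightarrow> tight (P v) (up \<rho> v)"
  using up_prog[of v \<rho>] prog_in tight_prog by metis+

lemma sat_at_mono:
  assumes "sat_at \<rho> v m" "\<And>w. w \<in> succs G v \<Longrightarrow> \<rho>' w \<le> \<rho> w" "m \<le> m'"
  shows "sat_at \<rho>' v m'"
proof -
  have "above (P v) m (\<rho> w) \<Longrightarrow> above (P v) m' (\<rho>' w)" if "w \<in> succs G v" for w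
    using above_mono trunc_mono assms(2)[OF that] assms(3) by blast
  then show ?thesis using assms(1) by (fastforce simp: sat_at_def split: if_splits)
qed

text \<open>
  Temporary measures that a sequence of lifts starting at zero can reach: below every prefixed point
  of the lifting operators, even relative to a region \<open>N\<close> outside which \<open>\<mu>\<close> is only an upper bound.
\<close>

definition minimal :: "('v \<Rightarrow> measure) \<Rightarrow> bool" where
  "minimal \<rho> \<longleftrightarrow> (\<forall>N\<subseteq>V. \<forall>\<mu>. (\<forall>x. \<mu> x \<in> M) \<longrightarrow> (\<forall>x\<in>V - N. \<rho> x \<le> \<mu> x) \<longrightarrow>
     (\<forall>x\<in>N. sat_at \<mu> x (\<mu> x)) \<longrightarrow> (\<forall>x\<in>N. \<rho> x \<le> \<mu> x))"

lemma minimalD: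
  assumes "minimal \<rho>" "N \<subseteq> V" "\<And>x. \<mu> x \<in> M" "\<And>x. x \<in> V - N \<Longrightarrow> \<rho> x \<le> \<mu> x"
    "\<And>x. x \<in> N \<Longrightarrow> sat_at \<mu> x (\<mu> x)" "x \<in> V"
  shows "\<rho> x \<le> \<mu> x"
  using assms unfolding minimal_def by (cases "x \<in> N") blast+

text \<open>An invariant standing in for an explicit sequence of lifts. Tightness lets bounds on
  truncations extend to whole tuples.\<close>

definition reachable :: "('v \<Rightarrow> measure) \<Rightarrow> bool" where
  "reachable \<rho> \<longleftrightarrow> (\<forall>x. \<rho> x \<in> M) \<and> minimal \<rho> \<and> (\<forall>x. tight (P x) (\<rho> x))"

lemma reachable_zero: "reachable (\<lambda>_. Tuple (replicate len 0))"
  by (auto simp: reachable_def minimal_def tight_def zero_in zero_le)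

text \<open>If \<mu> bounds \<rho>, the progress condition of \<mu> at \<open>w\<close> also holds
  with the smaller successor values of \<rho>, so \<open>up \<rho> w\<close> does not exceed \<mu>
  at \<open>w\<close> either.\<close>

lemma reachable_lift:
  assumes "reachable \<rho>" "w \<in> V"
  shows "reachable (lift G \<rho> w)"
proof -
  have "minimal (lift G \<rho> w)"
    unfolding minimal_def
  proof (intro allI impI ballI)
    fix N \<mu> x
    assume N: "N \<subseteq> V" and \<mu>: "\<forall>x. \<mu> x \<in> M" and out: "\<forall>x\<in>V - N. lift G \<rho> w x \<le> \<mu> x"
      and sat: "\<forall>x\<in>N. sat_at \<mu> x (\<mu> x)" and x: "x \<in> N"
    have "\<rho> y \<le> lift G \<rho> w y" for y by (simp add: lift_eq)
    then have le: "\<rho> y \<le> \<mu> y" if "y \<in> V" for y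
      using minimalD[of \<rho> N \<mu> y] assms(1) N \<mu> out sat that
      unfolding reachable_def by (meson order_trans)
    show "lift G \<rho> w x \<le> \<mu> x"
    proof (cases "x = w")
      case True
      have "sat_at \<rho> w (\<mu> w)"
        using sat_at_mono[of \<mu> w "\<mu> w" \<rho>] sat x True le succs_sub by blast
      then show ?thesis
        using True up_le_iff[OF assms(2)] \<mu> le[OF assms(2)] by (simp add: lift_eq)
    next
      case False
      then show ?thesis using le x N by (auto simp: lift_eq)
    qed
  qed
  then show ?thesis
    using assms up_in tight_up by (auto simp: reachable_def lift_eq max_def)
qed

text \<open>If \<open>up \<rho> x\<close> were smaller than \<open>\<rho> x\<close>, lowering \<rho>
  at \<open>x\<close> to \<open>up \<rho> x\<close> would give a prefixed point relative to
  \<open>{x}\<close>, against minimality. Thus every value is explained by the current values of the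
  successors.\<close>

lemma le_up:
  assumes "reachable \<rho>" "x \<in> V"
  shows "\<rho> x \<le> up \<rho> x"
proof (rule ccontr)
  assume "\<not> \<rho> x \<le> up \<rho> x"
  then have less: "up \<rho> x < \<rho> x" by simp
  let ?\<mu> = "\<rho>(x := up \<rho> x)"
  have "sat_at \<rho> x (up \<rho> x)"
    using up_le_iff[OF assms(2) up_in[OF assms(2)], of \<rho> \<rho>] by simp
  then have "sat_at ?\<mu> x (up \<rho> x)"
    by (rule sat_at_mono) (use less in auto)
  then have sat: "sat_at ?\<mu> y (?\<mu> y)" if "y \<in> {x}" for y
    using that by simp
  have "minimal \<rho>" using assms(1) by (simp add: reachable_def)
  then have "\<rho> x \<le> ?\<mu> x"
  proof (rule minimalD[where N = "{x}" and \<mu> = "?\<mu>"])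
    show "?\<mu> y \<in> M" for y
      using assms up_in by (simp add: reachable_def)
  qed (use assms(2) sat in auto)
  then show False using less by simp
qed

end

section \<open>Attractors\<close>

lemma attr_subset: "attr G p W S U \<subseteq> S \<union> U"
proof
  fix x assume "x \<in> attr G p W S U"
  then show "x \<in> S \<union> U" by induction auto
qed

lemma attr_cases:
  assumes "x \<in> attr G p W S U" "x \<notin> U"
  shows "x \<in> S" "x \<in> owned G p \<and> succs G x \<inter> attr G p W S U \<noteq> {} \<or>
    x \<in> owned G (opponent p) \<and> succs G x \<inter> W \<subseteq> attr G p W S U"
  using assms by (auto elim: attr.cases)

context parity
begin

lemma owned_opponent: "x \<in> owned G p \<Longrightarrow> x \<in> owned G (opponent p) \<Longrightarrow> False"
  using owned_disj by (cases p) auto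

text \<open>The rank is the round in which a vertex enters the attractor. Finite rounds suffice
  since every vertex has finitely many successors.\<close>

lemma attr_ranking:
  fixes p W S U
  defines "A \<equiv> attr G p W S U"
  obtains r :: "'v \<Rightarrow> nat" where
    "\<And>x. x \<in> A - U \<Longrightarrow> x \<in> owned G p \<Longrightarrow> \<exists>w\<in>succs G x \<inter> A. r w < r x"
    "\<And>x w. x \<in> A - U \<Longrightarrow> x \<in> owned G (opponent p) \<Longrightarrow> w \<in> succs G x \<inter> W \<Longrightarrow> w \<in> A \<and> r w < r x"
proof -
  define lev where "lev = rec_nat U (\<lambda>_ X. X \<union> {x \<in> S.
    x \<in> owned G p \<and> succs G x \<inter> X \<noteq> {} \<or> x \<in> owned G (opponent p) \<and> succs G x \<inter> W \<subseteq> X})"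
  have lev0: "lev 0 = U" and levS: "lev (Suc n) = lev n \<union> {x \<in> S.
    x \<in> owned G p \<and> succs G x \<inter> lev n \<noteq> {} \<or> x \<in> owned G (opponent p) \<and> succs G x \<inter> W \<subseteq> lev n}" for n
    by (simp_all add: lev_def)
  have mono: "m \<le> n \<Longrightarrow> lev m \<subseteq> lev n" for m n
    by (induction n) (auto simp: le_Suc_eq levS)
  have sub: "lev n \<subseteq> A" for n
  proof (induction n)
    case 0 then show ?case by (auto simp: lev0 A_def intro: attr.target)
  next
    case (Suc n) then show ?case
      unfolding levS A_def by (auto intro: attr.own attr.opp)
  qed
  have ex: "\<exists>n. x \<in> lev n" if "x \<in> A" for x
    using that unfolding A_def
  proof induction
    case (target v) then show ?case using lev0 by blast
  next
    case (own v w)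
    then obtain n where "w \<in> lev n" by blast
    then have "v \<in> lev (Suc n)" using own by (auto simp: levS)
    then show ?case by blast
  next
    case (opp v)
    then obtain f where f: "\<And>w. w \<in> succs G v \<inter> W \<Longrightarrow> w \<in> lev (f w)" by metis
    \<comment> \<open>The last round in which a successor enters; the inserted 0 covers a vertex
      without successors in \<open>W\<close>.\<close>
    define n where "n = Max (insert 0 (f ` (succs G v \<inter> W)))"
    have "f w \<le> n" if "w \<in> succs G v \<inter> W" for w
      unfolding n_def using that by (intro Max_ge) auto
    then have "succs G v \<inter> W \<subseteq> lev n" using f mono by blast
    then have "v \<in> lev (Suc n)" using opp by (auto simp: levS)
    then show ?case by blast
  qed
  define r where "r x = (LEAST n. x \<in> lev n)" for x
  have r: "x \<in> lev (r x)" if "x \<in> A" for x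
    using ex[OF that] unfolding r_def by (rule LeastI_ex)
  have rle: "x \<in> lev n \<Longrightarrow> r x \<le> n" for x n
    unfolding r_def by (rule Least_le)
  have pre: "\<exists>n. r x = Suc n \<and> (x \<in> owned G p \<and> succs G x \<inter> lev n \<noteq> {} \<or>
      x \<in> owned G (opponent p) \<and> succs G x \<inter> W \<subseteq> lev n)" if x: "x \<in> A - U" for x
  proof -
    have "r x \<noteq> 0" using r[of x] x lev0 by (metis Diff_iff)
    then obtain n where n: "r x = Suc n" by (cases "r x") auto
    then have "x \<notin> lev n" using rle by fastforce
    then show ?thesis using r[of x] x n by (auto simp: levS)
  qed
  show thesis
  proof (rule that[of r])
    fix x assume x: "x \<in> A - U" "x \<in> owned G p"
    then obtain n w where "r x = Suc n" "w \<in> succs G x" "w \<in> lev n"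
      using pre[OF x(1)] owned_opponent by blast
    then have "w \<in> succs G x \<inter> A" "r w < r x"
      using rle[of w n] sub by (auto simp: less_Suc_eq_le)
    then show "\<exists>w\<in>succs G x \<inter> A. r w < r x" by blast
  next
    fix x w assume x: "x \<in> A - U" "x \<in> owned G (opponent p)" and w: "w \<in> succs G x \<inter> W"
    then obtain n where "r x = Suc n" "w \<in> lev n"
      using pre[OF x(1)] owned_opponent by blast
    then show "w \<in> A \<and> r w < r x"
      using rle[of w n] sub by (auto simp: less_Suc_eq_le)
  qed
qed

text \<open>Moving to a successor of smaller rank makes the rank fall along every play in
  \<open>W\<close> until the target is met, since all opponent moves within \<open>W\<close> lower
  it too.\<close>

lemma attracting_exists:
  assumes "W \<subseteq> V" "S \<subseteq> W" "U \<subseteq> W"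
  shows "\<exists>\<tau>. attracting G p W (attr G p W S U) U \<tau>"
proof -
  let ?A = "attr G p W S U"
  obtain r :: "'v \<Rightarrow> nat" where
    r1: "\<And>x. x \<in> ?A - U \<Longrightarrow> x \<in> owned G p \<Longrightarrow> \<exists>w\<in>succs G x \<inter> ?A. r w < r x" and
    r2: "\<And>x w. x \<in> ?A - U \<Longrightarrow> x \<in> owned G (opponent p) \<Longrightarrow> w \<in> succs G x \<inter> W \<Longrightarrow>
      w \<in> ?A \<and> r w < r x"
    using attr_ranking[of p W S U] by blast
  have "\<forall>x. \<exists>w. x \<in> ?A - U \<and> x \<in> owned G p \<longrightarrow> w \<in> succs G x \<inter> ?A \<and> r w < r x"
    using r1 by blast
  then obtain \<tau> where \<tau>: "\<And>x. x \<in> ?A - U \<Longrightarrow> x \<in> owned G p \<Longrightarrow>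
      \<tau> x \<in> succs G x \<inter> ?A \<and> r (\<tau> x) < r x"
    by metis
  have "\<exists>i. \<pi> i \<in> U \<and> (\<forall>j\<le>i. \<pi> j \<in> ?A)"
    if "\<pi> 0 \<in> ?A" "\<And>i. \<pi> i \<in> W \<and> \<pi> (Suc i) \<in> succs G (\<pi> i)"
      "\<And>i. \<pi> i \<in> (?A - U) \<inter> owned G p \<Longrightarrow> \<pi> (Suc i) = \<tau> (\<pi> i)" for \<pi>
    using that
  proof (induction "r (\<pi> 0)" arbitrary: \<pi> rule: less_induct)
    case less
    show ?case
    proof (cases "\<pi> 0 \<in> U")
      case True
      then show ?thesis using less.prems(1) by (intro exI[of _ 0]) auto
    next
      case False
      have "\<pi> 0 \<in> owned G p \<or> \<pi> 0 \<in> owned G (opponent p)"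
        using attr_cases(2)[OF less.prems(1) False] by blast
      then have 1: "\<pi> (Suc 0) \<in> ?A \<and> r (\<pi> (Suc 0)) < r (\<pi> 0)"
        using \<tau>[of "\<pi> 0"] r2[of "\<pi> 0" "\<pi> (Suc 0)"] less.prems(1) less.prems(2)[of 0]
          less.prems(2)[of "Suc 0"] less.prems(3)[of 0] False by force
      then obtain i where "\<pi> (Suc i) \<in> U" "\<forall>j\<le>i. \<pi> (Suc j) \<in> ?A"
        using less.hyps[of "\<lambda>i. \<pi> (Suc i)"] less.prems by blast
      then have "\<forall>j\<le>Suc i. \<pi> j \<in> ?A"
        using less.prems(1) by (metis Suc_le_mono not0_implies_Suc)
      then show ?thesis using \<open>\<pi> (Suc i) \<in> U\<close> by blast
    qed
  qed
  then have "attracting G p W ?A U \<tau>"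
    unfolding attracting_def using \<tau> by blast
  then show ?thesis by blast
qed

text \<open>Setting an attractor of \<open>\<box>\<close> to \<open>Top\<close> amounts to a sequence of lifts.\<close>

lemma reachable_set_top:
  assumes "reachable \<rho>" "W \<subseteq> V" "S \<subseteq> W" "U \<subseteq> W" "\<And>x. x \<in> U \<Longrightarrow> \<rho> x = Top"
    and esc: "\<And>x y. x \<in> W \<Longrightarrow> x \<in> VD \<Longrightarrow> y \<in> succs G x - W \<Longrightarrow> \<rho> y = Top"
  shows "reachable (set_top (attr G Square W S U - U) \<rho>)"
proof -
  let ?A = "attr G Square W S U" let ?\<rho> = "set_top (?A - U) \<rho>"
  have A: "?A \<subseteq> W" using attr_subset assms(3,4) by fastforce
  have topA: "?\<rho> x = Top" if "x \<in> ?A" for x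
    using that assms(5) by (auto simp: set_top_def)
  have "minimal ?\<rho>"
    unfolding minimal_def
  proof (intro allI impI ballI)
    fix N \<mu> z
    assume N: "N \<subseteq> V" and \<mu>: "\<forall>x. \<mu> x \<in> M" and out: "\<forall>x\<in>V - N. ?\<rho> x \<le> \<mu> x"
      and sat: "\<forall>x\<in>N. sat_at \<mu> x (\<mu> x)" and z: "z \<in> N"
    have "\<rho> y \<le> ?\<rho> y" for y by (simp add: set_top_def)
    then have le: "\<rho> y \<le> \<mu> y" if "y \<in> V" for y
      using minimalD[of \<rho> N \<mu> y] assms(1) N \<mu> out sat that
      unfolding reachable_def by (meson order_trans)
    have "\<mu> x = Top" if "x \<in> ?A" for x
      using that
    proof induction
      case (target x)
      then show ?case using le[of x] assms(2,4,5) by auto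
    next
      case (own x w)
      then have x: "x \<in> ?A" "x \<in> V" "x \<notin> VD"
        using attr.own[of x S G Square w W U] ownedD Square_iff by blast+
      show ?case
      proof (cases "x \<in> N")
        case True
        then have "sat_at \<mu> x (\<mu> x)" using sat by blast
        then have "above (P x) (\<mu> x) (\<mu> w)"
          using own.hyps x by (simp add: sat_at_def)
        then show ?thesis using own.IH above_not_Top by blast
      next
        case False
        then show ?thesis using out topA[OF x(1)] x(2) by force
      qed
    next
      case (opp x)
      then have x: "x \<in> ?A" "x \<in> V" "x \<in> VD" "x \<in> W"
        using attr.opp[of x S G Square W U] ownedD(1)[of x] assms(3) by auto
      show ?case
      proof (cases "x \<in> N")
        case True
        then have "sat_at \<mu> x (\<mu> x)" using sat by blast
        then obtain w where w: "w \<in> succs G x" "above (P x) (\<mu> x) (\<mu> w)"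
          using x by (auto simp: sat_at_def)
        have "\<mu> w = Top"
        proof (cases "w \<in> W")
          case True then show ?thesis using opp w by blast
        next
          case False
          then show ?thesis using esc[OF x(4,3)] w(1) le[of w] succs_sub by fastforce
        qed
        then show ?thesis using w above_not_Top by blast
      next
        case False
        then show ?thesis using out topA[OF x(1)] x(2) by force
      qed
    qed
    then show "?\<rho> z \<le> \<mu> z" using le[of z] z N by (auto simp: set_top_def)
  qed
  then show ?thesis using assms(1) by (auto simp: reachable_def set_top_def)
qed

section \<open>Regions\<close>

text \<open>For \<open>S \<subseteq> V\<close> this is the number of vertices of priority
  \<open>i\<close> outside \<open>S\<close>. A value below \<open>tup (slack S)\<close> is explained
  by vertices outside \<open>S\<close> alone.\<close>

definition slack :: "'v set \<Rightarrow> nat \<Rightarrow> nat" where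
  "slack S i = cap i - card {v \<in> S. P v = i}"

text \<open>For values in \<open>M\<close> this means \<open>Top\<close> or a tuple with every odd
  position up to \<open>k\<close> at its capacity.\<close>

definition full :: "nat \<Rightarrow> measure \<Rightarrow> bool" where
  "full k m \<longleftrightarrow> trunc k (tup cap) \<le> trunc k m"

lemma slack_le_cap [simp]: "slack S i \<le> cap i"
  by (simp add: slack_def)

lemma fin_prio [simp]: "S \<subseteq> V \<Longrightarrow> finite {v \<in> S. Q v}"
  by (rule finite_subset[OF _ fin_V]) auto

lemma card_prio_le_cap: "S \<subseteq> V \<Longrightarrow> card {v \<in> S. P v = i} \<le> cap i"
  unfolding cap_def by (intro card_mono) auto

lemma slack_antimono: "S \<subseteq> S' \<Longrightarrow> S' \<subseteq> V \<Longrightarrow> slack S' i \<le> slack S i"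
  unfolding slack_def by (intro diff_le_mono2 card_mono) auto

lemma slack_strict:
  assumes "S \<subseteq> S'" "S' \<subseteq> V" "v \<in> S'" "v \<notin> S" "P v = i"
  shows "slack S' i < slack S i"
proof -
  have "{v \<in> S. P v = i} \<subset> {v \<in> S'. P v = i}" using assms by auto
  then have "card {v \<in> S. P v = i} < card {v \<in> S'. P v = i}"
    using assms(2) by (intro psubset_card_mono) auto
  then show ?thesis
    using card_prio_le_cap[OF assms(2), of i] unfolding slack_def by linarith
qed

lemma slack_empty [simp]: "slack {} i = cap i"
  by (simp add: slack_def)

lemma slack_mono_tup: "S \<subseteq> S' \<Longrightarrow> S' \<subseteq> V \<Longrightarrow> tup (slack S') \<le> tup (slack S)"
  by (intro tup_mono slack_antimono)

text \<open>A spare slot at the odd position \<open>P v\<close> separates the bound from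
  \<open>tup cap\<close> after truncation. This is the common reason why neither irrelevant nor
  finally safe vertices are full.\<close>

lemma not_full_slack:
  assumes "v \<in> S" "S \<subseteq> V" "odd (P v)" "m \<le> tup f" "\<And>i. f i \<le> cap i" "f (P v) < cap (P v)"
  shows "\<not> full (P v) m"
proof -
  have "trunc (P v) (tup f) < trunc (P v) (tup cap)"
    using assms prio_less_dim by (intro tup_trunc_less) auto
  moreover have "trunc (P v) m \<le> trunc (P v) (tup f)" using trunc_mono assms by blast
  ultimately show ?thesis by (simp add: full_def)
qed

lemma not_full_if_le_slack:
  assumes "v \<in> S" "S \<subseteq> V" "odd (P v)" "m \<le> tup (slack S)"
  shows "\<not> full (P v) m"
  using assms slack_strict[of "{}" S v "P v"] by (intro not_full_slack[of v S _ "slack S"]) auto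

lemma full_mono: "full k m \<Longrightarrow> m \<le> m' \<Longrightarrow> full k m'"
  unfolding full_def using trunc_mono order_trans by blast

lemma full_Top [simp]: "full k Top"
  by (simp add: full_def)

text \<open>
  The sets \<open>W\<close> on which the procedure operates. \<open>\<Diamond>\<close> can leave \<open>W\<close> only to vertices that are lost;
  \<open>\<box>\<close> can leave it only to vertices whose measure is explained by vertices outside \<open>W\<close> alone.
\<close>

definition region :: "('v \<Rightarrow> measure) \<Rightarrow> 'v set \<Rightarrow> bool" where
  "region \<rho> W \<longleftrightarrow> W \<subseteq> V \<and> (\<forall>x\<in>W. succs G x \<inter> W \<noteq> {}) \<and>
     (\<forall>x\<in>W. x \<in> VD \<longrightarrow> (\<forall>y\<in>succs G x - W. \<rho> y = Top)) \<and>
     (\<forall>x\<in>W. x \<in> VS \<longrightarrow> (\<forall>y\<in>succs G x - W. \<rho> y \<le> tup (slack W)))"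

lemma regionD:
  assumes "region \<rho> W"
  shows "W \<subseteq> V" "x \<in> W \<Longrightarrow> succs G x \<inter> W \<noteq> {}"
    "x \<in> W \<Longrightarrow> x \<in> VD \<Longrightarrow> y \<in> succs G x \<Longrightarrow> y \<notin> W \<Longrightarrow> \<rho> y = Top"
    "x \<in> W \<Longrightarrow> x \<in> VS \<Longrightarrow> y \<in> succs G x \<Longrightarrow> y \<notin> W \<Longrightarrow> \<rho> y \<le> tup (slack W)"
  using assms unfolding region_def by blast+

lemma regionD_VS_not_Top:
  "region \<rho> W \<Longrightarrow> x \<in> W \<Longrightarrow> x \<in> VS \<Longrightarrow> y \<in> succs G x \<Longrightarrow> y \<notin> W \<Longrightarrow> \<rho> y \<noteq> Top"
  using regionD(4) by fastforce

text \<open>The trace that a lift of \<open>v\<close> to \<open>Top\<close> leaves on its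
  successors, and all that is later used about the cause of that lift.\<close>

definition just_lifted :: "('v \<Rightarrow> measure) \<Rightarrow> 'v \<Rightarrow> bool" where
  "just_lifted \<rho> v \<longleftrightarrow> odd (P v) \<and>
     (if v \<in> VD then \<forall>y\<in>succs G v. full (P v) (\<rho> y) else \<exists>y\<in>succs G v. full (P v) (\<rho> y))"

text \<open>\<open>prog_eq_Top\<close> applies at successors that are not yet lost. The region
  provides one: a vertex of \<open>Diamond\<close> has a successor in \<open>W\<close>, and a vertex
  of \<open>Square\<close> cannot leave \<open>W\<close> to a lost vertex.\<close>

lemma just_lifted_lift:
  assumes "reachable \<rho>" "region \<rho> W" "v \<in> W" "\<And>w. w \<in> W \<Longrightarrow> \<rho> w \<noteq> Top" "lift G \<rho> v v = Top"
  shows "just_lifted (lift G \<rho> v) v"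
proof -
  have vV: "v \<in> V" using regionD(1)[OF assms(2)] assms(3) by auto
  have "up \<rho> v = Top" using assms(4)[OF assms(3)] assms(5) by (simp add: lift_eq max_def split: if_splits)
  then have top: "if v \<in> VD then \<forall>w\<in>succs G v. prog G \<rho> v w = Top
      else \<exists>w\<in>succs G v. prog G \<rho> v w = Top"
    using le_up_iff[OF vV, of Top \<rho>] by (auto split: if_splits)
  have in_M: "\<rho> y \<in> M" for y using assms(1) by (simp add: reachable_def)
  have le: "\<rho> y \<le> lift G \<rho> v y" for y by (simp add: lift_eq)
  have f: "odd (P v) \<and> full (P v) (\<rho> y)" if "prog G \<rho> v y = Top" "\<rho> y \<noteq> Top" for y
    using prog_eq_Top[OF that(1) in_M that(2)] by (auto simp: full_def)
  show ?thesis
  proof (cases "v \<in> VD")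
    case True
    obtain y where "y \<in> succs G v" "y \<in> W" using regionD(2)[OF assms(2,3)] by blast
    then have "odd (P v)" using f[of y] top True assms(4) by auto
    moreover have "full (P v) (\<rho> y)" if "y \<in> succs G v" for y
      using f[of y] top True that by (cases "\<rho> y = Top") auto
    ultimately show ?thesis using True by (auto simp: just_lifted_def intro: full_mono[OF _ le])
  next
    case False
    then obtain y where y: "y \<in> succs G v" "prog G \<rho> v y = Top" using top by auto
    have "\<rho> y \<noteq> Top"
      using y(1) assms(4) regionD_VS_not_Top[OF assms(2,3)] Square_iff[OF vV] False by blast
    then show ?thesis using f[OF y(2)] y(1) False by (auto simp: just_lifted_def intro: full_mono[OF _ le])
  qed
qed

text \<open>
  Vertices from which \<open>\<Diamond>\<close> forces a priority below \<open>P v\<close>: along the attractor, each one uses up a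
  slot of its own priority.
\<close>

lemma irrelevant_bound:
  assumes reach: "reachable \<rho>" and reg: "region \<rho> W" and v: "v \<in> W"
    and top: "\<And>w. w \<in> W \<Longrightarrow> \<rho> w = Top \<longleftrightarrow> w = v" and jl: "just_lifted \<rho> v"
  defines "I \<equiv> attractor G Diamond W {w \<in> W. P w < P v}"
  shows "v \<notin> I" "\<And>y. y \<in> I \<Longrightarrow> \<rho> y \<le> tup (slack (W - I))"
proof -
  let ?k = "P v"
  \<comment> \<open>The vertices whose slots are still withheld. Available are all slots of
    priorities below \<open>P v\<close>, those outside \<open>W\<close>, and those of
    \<open>X\<close>.\<close>
  let ?W = "\<lambda>X. {w \<in> W. ?k \<le> P w} - X"
  have WV: "W \<subseteq> V" using regionD(1)[OF reg] .
  have sub: "?W X \<subseteq> V" for X using WV by auto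
  have odd: "odd ?k" using jl by (simp add: just_lifted_def)
  have IW: "I \<subseteq> W" unfolding I_def using attr_subset by fastforce
  \<comment> \<open>The bounds are collected for a maximal set \<open>X\<close> of attracted
    vertices rather than along the attractor itself, since adding a vertex relaxes the bound for all
    members at once.\<close>
  define Q where "Q X \<longleftrightarrow> X \<subseteq> I \<and> v \<notin> X \<and> (\<forall>y\<in>X. \<rho> y \<le> tup (slack (?W X)))" for X
  have "finite {X. Q X}"
    by (rule finite_subset[of _ "Pow V"]) (use IW WV in \<open>auto simp: Q_def\<close>)
  moreover have "Q {}" by (simp add: Q_def)
  ultimately obtain X where X: "Q X" and max: "\<And>Y. Q Y \<Longrightarrow> X \<subseteq> Y \<Longrightarrow> Y = X"
    using finite_has_maximal[of "{X. Q X}"] by blast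
  have bX: "\<rho> y \<le> tup (slack (?W X))" if "y \<in> X" for y using X that by (simp add: Q_def)
  have bout: "\<rho> y \<le> tup (slack (?W X))" if "x \<in> W" "x \<in> VS" "y \<in> succs G x" "y \<notin> W" for x y
    using regionD(4)[OF reg that] slack_mono_tup[of "?W X" W] WV by (auto intro: order_trans)
  have grow: "z \<in> X" if "z \<in> I" "z \<noteq> v" "\<rho> z \<le> tup (slack (?W (insert z X)))" for z
  proof -
    have "\<rho> y \<le> tup (slack (?W (insert z X)))" if "y \<in> X" for y
      using bX[OF that] slack_mono_tup[of "?W (insert z X)" "?W X"] sub by (auto intro: order_trans)
    then have "Q (insert z X)" using that X by (auto simp: Q_def)
    then show ?thesis using max by blast
  qed
  \<comment> \<open>At positions up to \<open>P z\<close> all capacities are available, and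
    tightness of \<rho> at \<open>z\<close> settles the later positions.\<close>
  have low: "\<rho> z \<le> tup (slack (?W (insert z X)))" if "z \<in> W" "z \<noteq> v" "P z < ?k" for z
  proof -
    have "trunc (P z) (\<rho> z) \<le> trunc (P z) (tup (slack (?W (insert z X))))"
    proof (rule trunc_le_tup_cap)
      fix i assume "i \<le> P z"
      then have "{w \<in> ?W (insert z X). P w = i} = {}" using that by auto
      then show "cap i \<le> slack (?W (insert z X)) i" unfolding slack_def by (metis card.empty diff_zero order_refl)
    qed (use reach top that in \<open>auto simp: reachable_def\<close>)
    moreover have "tup (slack (?W (insert z X))) \<in> M" by (rule tup_in) simp
    moreover have "tight (P z) (\<rho> z)" using reach by (simp add: reachable_def)
    ultimately show ?thesis by (simp add: tight_def)
  qed
  \<comment> \<open>The successor uses only slots already available; the slot of \<open>z\<close>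
    itself supplies the increase demanded when \<open>P z\<close> is odd.\<close>
  have grow': "z \<in> X" if "z \<in> I" "z \<noteq> v" "y \<in> succs G z" "\<rho> z \<le> prog G \<rho> z y"
    "\<rho> y \<le> tup (slack (?W X))" for z y
  proof (rule ccontr)
    assume z: "z \<notin> X"
    have "\<rho> z \<le> tup (slack (?W (insert z X)))"
    proof (cases "P z < ?k")
      case True
      then show ?thesis using low IW that by blast
    next
      case False
      have "above (P z) (tup (slack (?W (insert z X)))) (tup (slack (?W X)))"
        using that(1) z False WV IW prio_less_dim sub
        by (intro above_tup slack_antimono conjI slack_strict[of _ _ z]) auto
      then have "above (P z) (tup (slack (?W (insert z X)))) (\<rho> y)"
        using above_mono trunc_mono that(5) by blast
      then have "prog G \<rho> z y \<le> tup (slack (?W (insert z X)))"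
        by (intro prog_le tup_in) auto
      then show ?thesis using that(4) by order
    qed
    then show False using grow that z by blast
  qed
  \<comment> \<open>The slot of \<open>v\<close> is never released, as \<open>v\<close> is not in
    \<open>X\<close>.\<close>
  have nfull: "\<not> full ?k (\<rho> y)" if "\<rho> y \<le> tup (slack (?W X))" for y
    using not_full_if_le_slack[of v "?W X"] v X sub odd that by (auto simp: Q_def)
  \<comment> \<open>By maximality the attracted vertices already belong to \<open>X\<close>. The
    vertex \<open>v\<close> cannot occur: an attractor step at \<open>v\<close> would contradict the
    full successors that \<open>just_lifted\<close> demands.\<close>
  have IX: "z \<in> X" if "z \<in> I" for z
    using that unfolding I_def
  proof induction
    case (target z)
    then have "z \<in> I" unfolding I_def by (rule attr.target)
    moreover have "z \<in> W" "z \<noteq> v" "P z < ?k" using target by auto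
    ultimately show ?case using grow low by blast
  next
    case (own z w)
    have zI: "z \<in> I" unfolding I_def using own.hyps by (rule attr.own)
    have zV: "z \<in> V" using own WV by auto
    have "z \<noteq> v"
      using jl own.hyps nfull[OF bX[OF own.IH]] by (auto simp: just_lifted_def)
    moreover have "\<rho> z \<le> prog G \<rho> z w"
      using le_up[OF reach zV] own.hyps le_up_iff[OF zV] by simp
    ultimately show ?case using grow'[of z w] zI own bX by blast
  next
    case (opp z)
    have zI: "z \<in> I" unfolding I_def using opp.hyps by (rule attr.opp)
    have z: "z \<in> W" "z \<in> VS" using opp.hyps by simp_all
    then have z': "z \<in> V" "z \<notin> VD" using WV Square_iff by auto
    have b: "\<rho> y \<le> tup (slack (?W X))" if "y \<in> succs G z" for y
      using bX opp.IH bout[OF z] that by (cases "y \<in> W") blast+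
    have "z \<noteq> v" using jl z' b nfull unfolding just_lifted_def by metis
    moreover obtain y where "y \<in> succs G z" "\<rho> z \<le> prog G \<rho> z y"
      using le_up[OF reach z'(1)] le_up_iff[OF z'(1)] z'(2) by auto
    ultimately show ?case using grow'[of z y] zI b by blast
  qed
  have XI: "X = I" using IX X by (auto simp: Q_def)
  then show "v \<notin> I" using X by (simp add: Q_def)
  \<comment> \<open>Every vertex of \<open>W\<close> with priority below \<open>P v\<close> is a
    target of the attractor, so the restriction on priorities disappears.\<close>
  have "?W I = W - I" unfolding I_def by (auto intro: attr.target)
  then show "\<rho> y \<le> tup (slack (W - I))" if "y \<in> I" for y
    using bX[of y] that by (simp add: XI)
qed

text \<open>
  The counterpart for a set \<open>N\<close> that a final measure \<open>\<rho>'\<close> does not declare lost: for each odd \<open>i\<close>,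
  counting the vertices of \<open>N\<close> with priority \<open>i\<close> and at most the same \<open>\<rho>'\<close>-value yields a
  progress measure on \<open>N\<close> that bounds every measure reachable before.
\<close>

lemma final_bound:
  assumes reach: "reachable \<rho>" and N: "N \<subseteq> S" "S \<subseteq> V" "v \<in> S" "v \<notin> N" "odd (P v)"
    and fin: "\<And>x. x \<in> N \<Longrightarrow> sat_at \<rho>' x (\<rho>' x)" "\<And>x. x \<in> N \<Longrightarrow> \<rho>' x \<noteq> Top"
    and VD_exit: "\<And>x y. x \<in> N \<Longrightarrow> x \<in> VD \<Longrightarrow> y \<in> succs G x \<Longrightarrow> y \<notin> N \<Longrightarrow> \<rho>' y = Top"
    and VS_exit: "\<And>x y. x \<in> N \<Longrightarrow> x \<in> VS \<Longrightarrow> y \<in> succs G x \<Longrightarrow> y \<notin> N \<Longrightarrow>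
      \<rho>' y = Top \<or> \<rho> y \<le> tup (slack S)"
    and y: "y \<in> N"
  shows "\<not> full (P v) (\<rho> y)"
proof -
  \<comment> \<open>Comparing only prefixes up to \<open>i\<close> makes the counts monotone along
    progress edges of \<open>\<rho>'\<close>; the slots outside \<open>S\<close> are granted from
    the start.\<close>
  define f where "f x i = slack S i + card {z \<in> N. P z = i \<and> trunc i (\<rho>' z) \<le> trunc i (\<rho>' x)}" for x i
  define \<mu> where "\<mu> x = (if x \<in> N then tup (f x) else \<rho> x)" for x
  have NV: "N \<subseteq> V" using N by auto
  have finN: "finite {z \<in> N. Q z}" for Q using NV by (rule fin_prio)
  have f_le: "f x i \<le> slack S i + card {z \<in> N. P z = i}" for x i
    unfolding f_def using finN by (auto intro!: card_mono)
  have NS: "card {z \<in> N. P z = i} \<le> card {z \<in> S. P z = i}" for i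
    using N by (intro card_mono) auto
  have f_cap: "f x i \<le> cap i" for x i
    using f_le[of x i] NS[of i] card_prio_le_cap[OF N(2), of i] unfolding slack_def by linarith
  \<comment> \<open>The vertex \<open>v\<close> lies in \<open>S\<close> but not in
    \<open>N\<close>, so neither summand counts it.\<close>
  have f_v: "f x (P v) < cap (P v)" for x
  proof -
    have "{z \<in> N. P z = P v} \<subset> {z \<in> S. P z = P v}" using N by auto
    then have "card {z \<in> N. P z = P v} < card {z \<in> S. P z = P v}"
      using N(2) by (intro psubset_card_mono) auto
    then show ?thesis
      using f_le[of x "P v"] card_prio_le_cap[OF N(2), of "P v"] unfolding slack_def by linarith
  qed
  \<comment> \<open>Along a progress edge inside \<open>N\<close> the prefixes of
    \<open>\<rho>'\<close> do not grow. At an odd priority they drop strictly, so that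
    \<open>x\<close> is counted for itself but not for \<open>w\<close>.\<close>
  have inner: "above (P x) (tup (f x)) (tup (f w))"
    if "x \<in> N" "w \<in> N" "above (P x) (\<rho>' x) (\<rho>' w)" for x w
  proof (rule above_tup)
    have le: "trunc i (\<rho>' w) \<le> trunc i (\<rho>' x)" if "i \<le> P x" for i
      using above_trunc_le[OF \<open>above _ _ _\<close>] that by (rule trunc_mono_le[rotated])
    show "f w i \<le> f x i" if "i \<le> P x" for i
      unfolding f_def using finN le[OF that] by (auto intro!: card_mono)
    assume o: "odd (P x)"
    then have "\<not> trunc (P x) (\<rho>' x) \<le> trunc (P x) (\<rho>' w)"
      using that fin(2) by (auto simp: above_def)
    moreover let ?L = "\<lambda>u. {z \<in> N. P z = P x \<and> trunc (P x) (\<rho>' z) \<le> trunc (P x) (\<rho>' u)}"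
    have "?L w \<subseteq> ?L x" using le[of "P x"] by (auto intro: order_trans)
    moreover have "x \<in> ?L x" using that(1) by simp
    ultimately have "?L w \<subset> ?L x" by blast
    then show "P x < len \<and> f w (P x) < f x (P x)"
      unfolding f_def using finN prio_less_dim NV that(1) by (auto intro!: psubset_card_mono)
  qed
  \<comment> \<open>Each \<open>x\<close> counts itself at its own priority, which gives the strict
    increase over the slots outside \<open>S\<close>.\<close>
  have outer: "above (P x) (tup (f x)) (\<rho> w)" if "x \<in> N" "\<rho> w \<le> tup (slack S)" for x w
  proof -
    have "0 < card {z \<in> N. P z = P x \<and> trunc (P x) (\<rho>' z) \<le> trunc (P x) (\<rho>' x)}"
      using finN that(1) by (auto simp: card_gt_0_iff)
    then have "above (P x) (tup (f x)) (tup (slack S))"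
      using prio_less_dim NV that(1) by (intro above_tup) (auto simp: f_def)
    then show ?thesis using above_mono trunc_mono that(2) by blast
  qed
  have "\<rho> y \<le> \<mu> y"
  proof (rule minimalD[where N = N and \<mu> = \<mu>])
    show "minimal \<rho>" using reach by (simp add: reachable_def)
    show "\<mu> x \<in> M" for x
      using reach f_cap tup_in by (auto simp: \<mu>_def reachable_def)
    show "\<rho> x \<le> \<mu> x" if "x \<in> V - N" for x using that by (simp add: \<mu>_def)
    fix x assume x: "x \<in> N"
    then have xV: "x \<in> V" using NV by auto
    have not_Top: "\<rho>' w \<noteq> Top" if "above (P x) (\<rho>' x) (\<rho>' w)" for w
      using above_not_Top[OF that fin(2)[OF x]] .
    show "sat_at \<mu> x (\<mu> x)"
    proof (cases "x \<in> VD")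
      case True
      then obtain w where w: "w \<in> succs G x" "above (P x) (\<rho>' x) (\<rho>' w)"
        using fin(1)[OF x] by (auto simp: sat_at_def)
      then have "w \<in> N" using VD_exit[OF x True] not_Top by blast
      then have "above (P x) (\<mu> x) (\<mu> w)" using inner x w by (simp add: \<mu>_def)
      then show ?thesis using True w by (auto simp: sat_at_def)
    next
      case False
      have "above (P x) (\<mu> x) (\<mu> w)" if w: "w \<in> succs G x" for w
      proof -
        have a: "above (P x) (\<rho>' x) (\<rho>' w)"
          using fin(1)[OF x] False w by (auto simp: sat_at_def)
        show ?thesis
          using inner[OF x _ a] outer[OF x] VS_exit[OF x _ w] not_Top[OF a] False Square_iff[OF xV] x
          by (auto simp: \<mu>_def)
      qed
      then show ?thesis using False by (auto simp: sat_at_def)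
    qed
  qed (use NV y in auto)
  then show ?thesis
    using not_full_slack[of v S _ "f y"] N f_cap f_v y by (auto simp: \<mu>_def)
qed

section \<open>Plays\<close>

definition min_inf :: "(nat \<Rightarrow> 'v) \<Rightarrow> nat" where
  "min_inf \<pi> = (LEAST k. infinite {i. P (\<pi> i) = k})"

lemma won_by_iff: "won_by G Diamond \<pi> \<longleftrightarrow> even (min_inf \<pi>)" "won_by G Square \<pi> \<longleftrightarrow> odd (min_inf \<pi>)"
  by (simp_all add: min_inf_def)

lemma min_inf_infinite:
  assumes "\<And>i. \<pi> i \<in> V"
  shows "infinite {i. P (\<pi> i) = min_inf \<pi>}"
proof -
  have "finite (range (\<lambda>i. P (\<pi> i)))"
    by (rule finite_subset[of _ "P ` V"]) (use assms in auto)
  then obtain i where "infinite {j \<in> UNIV. P (\<pi> j) = P (\<pi> i)}"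
    using pigeonhole_infinite[of UNIV "\<lambda>i. P (\<pi> i)"] by auto
  then have "\<exists>k. infinite {j. P (\<pi> j) = k}" by auto
  then show ?thesis unfolding min_inf_def by (rule LeastI_ex)
qed

lemma min_inf_eventually: "\<exists>n. \<forall>i\<ge>n. min_inf \<pi> \<le> P (\<pi> i)"
proof -
  have "finite {i. P (\<pi> i) = k}" if "k < min_inf \<pi>" for k
    using not_less_Least[of k "\<lambda>k. infinite {i. P (\<pi> i) = k}"] that unfolding min_inf_def by auto
  then have "finite (\<Union>k<min_inf \<pi>. {i. P (\<pi> i) = k})" by auto
  moreover have "(\<Union>k<min_inf \<pi>. {i. P (\<pi> i) = k}) = {i. P (\<pi> i) < min_inf \<pi>}" by auto
  ultimately obtain n where "\<forall>i\<in>{i. P (\<pi> i) < min_inf \<pi>}. i < n"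
    using finite_nat_set_iff_bounded by auto
  then show ?thesis by (intro exI[of _ n]) (auto simp: not_less[symmetric])
qed

lemma min_inf_shift: "min_inf (\<lambda>i. \<pi> (n + i)) = min_inf \<pi>"
proof -
  have "finite {i. P (\<pi> (n + i)) = k} \<longleftrightarrow> finite {i. P (\<pi> i) = k}" for k
  proof
    assume "finite {i. P (\<pi> (n + i)) = k}"
    then have "finite ({..<n} \<union> (\<lambda>i. n + i) ` {i. P (\<pi> (n + i)) = k})" by auto
    moreover have "{i. P (\<pi> i) = k} \<subseteq> {..<n} \<union> (\<lambda>i. n + i) ` {i. P (\<pi> (n + i)) = k}"
    proof
      fix i assume "i \<in> {i. P (\<pi> i) = k}"
      then show "i \<in> {..<n} \<union> (\<lambda>i. n + i) ` {i. P (\<pi> (n + i)) = k}"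
        by (cases "i < n") (auto simp: image_iff intro!: exI[of _ "i - n"])
    qed
    ultimately show "finite {i. P (\<pi> i) = k}" by (rule finite_subset[rotated])
  next
    assume "finite {i. P (\<pi> i) = k}"
    then have "finite ((\<lambda>i. n + i) -` {i. P (\<pi> i) = k})"
      by (rule finite_vimageI) simp
    then show "finite {i. P (\<pi> (n + i)) = k}" by (simp add: vimage_def)
  qed
  then show ?thesis by (simp add: min_inf_def)
qed

lemma min_inf_eqI:
  assumes "infinite {i. P (\<pi> i) = k}" "\<And>i. k \<le> P (\<pi> i)"
  shows "min_inf \<pi> = k"
  unfolding min_inf_def
proof (rule Least_equality)
  fix k' assume "infinite {i. P (\<pi> i) = k'}"
  then obtain i where "P (\<pi> i) = k'" by (metis (mono_tags) Collect_empty_eq finite.emptyI)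
  then show "k \<le> k'" using assms(2) by auto
qed (rule assms(1))

text \<open>The two strategies are played against each other; the least recurring priority of the
  resulting play would be both even and odd.\<close>

lemma not_both_winning:
  assumes "v \<in> V" "winning_from G Diamond f v" "winning_from G Square g v"
  shows False
proof -
  \<comment> \<open>Strategies are partial; where one is undefined an arbitrary successor is
    taken.\<close>
  define move where "move e x = (case e of Some w \<Rightarrow> w | None \<Rightarrow> SOME w. w \<in> succs G x)" for e x
  define nxt where "nxt h = move (if last h \<in> VD then f h else g h) (last h)" for h
  \<comment> \<open>Whole histories are built, since the strategies need not be positional.\<close>
  define hist where "hist = rec_nat [v] (\<lambda>_ h. h @ [nxt h])"
  have h0: "hist 0 = [v]" and hS: "hist (Suc i) = hist i @ [nxt (hist i)]" for i
    by (simp_all add: hist_def)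
  define \<pi> where "\<pi> i = last (hist i)" for i
  have \<pi>S: "\<pi> (Suc i) = nxt (hist i)" for i by (simp add: \<pi>_def hS)
  have hist: "hist i = map \<pi> [0..<Suc i]" for i
    by (induction i) (simp_all add: h0 hS \<pi>S, simp add: \<pi>_def h0)
  have split: "hist i = butlast (hist i) @ [\<pi> i]" for i
    by (simp add: hist)
  have edge: "\<pi> (Suc i) \<in> succs G (\<pi> i)" if "\<pi> i \<in> V" for i
  proof -
    let ?e = "if \<pi> i \<in> VD then f (hist i) else g (hist i)"
    have nx: "\<pi> (Suc i) = move ?e (\<pi> i)" by (simp only: \<pi>S nxt_def \<pi>_def[symmetric])
    show ?thesis
    proof (cases ?e)
      case None
      then show ?thesis
        using some_in_eq[of "succs G (\<pi> i)"] succs_nonempty[OF that] nx by (simp add: move_def)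
    next
      case (Some w)
      have "\<pi> i \<in> VD \<Longrightarrow> f (butlast (hist i) @ [\<pi> i]) = Some w \<Longrightarrow> (\<pi> i, w) \<in> edges G"
        "\<pi> i \<in> VS \<Longrightarrow> g (butlast (hist i) @ [\<pi> i]) = Some w \<Longrightarrow> (\<pi> i, w) \<in> edges G"
        using assms(2,3) unfolding winning_from_def strategy_def by blast+
      then have "(\<pi> i, w) \<in> edges G"
        using Some Square_iff[OF that] split[of i] by (auto split: if_splits)
      then show ?thesis using nx Some by (simp add: move_def succs_def)
    qed
  qed
  have V: "\<pi> i \<in> V" for i
  proof (induction i)
    case 0 then show ?case using assms(1) by (simp add: \<pi>_def h0)
  next
    case (Suc i) then show ?case using edge succs_sub by blast
  qed
  have "play G v \<pi>"
    using edge V by (auto simp: play_def succs_def \<pi>_def h0)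
  moreover have "consistent G Diamond f \<pi>" "consistent G Square g \<pi>"
    unfolding consistent_def using Square_iff[OF V]
    by (auto simp: hist[symmetric] \<pi>S nxt_def move_def \<pi>_def[symmetric] simp del: upt_Suc)
  ultimately have "won_by G Diamond \<pi>" "won_by G Square \<pi>"
    using assms(2,3) unfolding winning_from_def by blast+
  then show False by (simp add: won_by_iff)
qed

text \<open>\<open>X\<close> collects the lost vertices outside \<open>T\<close> on which winning is accounted for elsewhere.\<close>

definition dominion :: "('v \<Rightarrow> 'v option) \<Rightarrow> 'v set \<Rightarrow> 'v set \<Rightarrow> bool" where
  "dominion \<sigma> T X \<longleftrightarrow> T \<subseteq> V \<and>
     (\<forall>x\<in>T. x \<in> VS \<longrightarrow> (\<exists>y\<in>succs G x \<inter> (T \<union> X). \<sigma> x = Some y)) \<and>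
     (\<forall>x\<in>T. x \<in> VD \<longrightarrow> succs G x \<subseteq> T \<union> X) \<and>
     (\<forall>\<pi>. (\<forall>i. \<pi> i \<in> T \<and> \<pi> (Suc i) \<in> succs G (\<pi> i) \<and>
              (\<pi> i \<in> VS \<longrightarrow> \<sigma> (\<pi> i) = Some (\<pi> (Suc i)))) \<longrightarrow> odd (min_inf \<pi>))"

lemma dominion_empty [simp]: "dominion \<sigma> {} X"
  by (simp add: dominion_def)

lemma dominion_cong:
  assumes "\<And>x. x \<in> T \<Longrightarrow> \<sigma> x = \<sigma>' x"
  shows "dominion \<sigma> T X \<longleftrightarrow> dominion \<sigma>' T X"
proof -
  have "(\<forall>i. \<pi> i \<in> T \<and> \<pi> (Suc i) \<in> succs G (\<pi> i) \<and> (\<pi> i \<in> VS \<longrightarrow> \<sigma> (\<pi> i) = Some (\<pi> (Suc i)))) \<longleftrightarrow>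
    (\<forall>i. \<pi> i \<in> T \<and> \<pi> (Suc i) \<in> succs G (\<pi> i) \<and> (\<pi> i \<in> VS \<longrightarrow> \<sigma>' (\<pi> i) = Some (\<pi> (Suc i))))" for \<pi>
    using assms by metis
  moreover have "(\<forall>x\<in>T. x \<in> VS \<longrightarrow> (\<exists>y\<in>succs G x \<inter> (T \<union> X). \<sigma> x = Some y)) \<longleftrightarrow>
    (\<forall>x\<in>T. x \<in> VS \<longrightarrow> (\<exists>y\<in>succs G x \<inter> (T \<union> X). \<sigma>' x = Some y))"
    using assms by simp
  ultimately show ?thesis unfolding dominion_def by simp
qed

lemma dominion_play:
  assumes "dominion \<sigma> T X" "\<And>i. \<pi> i \<in> T" "\<And>i. \<pi> (Suc i) \<in> succs G (\<pi> i)"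
    "\<And>i. \<pi> i \<in> VS \<Longrightarrow> \<sigma> (\<pi> i) = Some (\<pi> (Suc i))"
  shows "odd (min_inf \<pi>)"
  using assms unfolding dominion_def by blast

lemma dominion_step:
  assumes "dominion \<sigma> T X" "x \<in> T" "y \<in> succs G x" "x \<in> VS \<Longrightarrow> \<sigma> x = Some y"
  shows "y \<in> T \<union> X"
proof (cases "x \<in> VS")
  case True
  then obtain y' where "y' \<in> T \<union> X" "\<sigma> x = Some y'"
    using assms unfolding dominion_def by blast
  then show ?thesis using assms(4) True by simp
next
  case False
  then have "x \<in> VD" using Square_iff assms unfolding dominion_def by blast
  then show ?thesis using assms unfolding dominion_def by blast
qed

text \<open>\<open>T\<close> was lost earlier in the same activation, \<open>R\<close> in the
  recursive call. A play within \<open>T \<union> A\<close> that enters \<open>T\<close> stays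
  there. Otherwise it is attracted to \<open>RES \<union> R\<close> and never leaves it; then it
  either remains in \<open>R\<close> from some point on, or returns to \<open>RES\<close> infinitely
  often and hence to \<open>v\<close>, whose odd priority is the least there.\<close>

lemma dominion_resume:
  assumes T: "dominion \<sigma> T X" and R: "dominion \<sigma> R (T \<union> X \<union> RES)"
    and sets: "RES \<union> R \<subseteq> A" "A \<subseteq> W" "W \<subseteq> V" "W \<inter> (T \<union> X) = {}" "T \<inter> X = {}"
    and RES: "attracting G Square W RES {v} \<tau>" "v \<in> RES"
      "\<And>x. x \<in> RES - {v} \<Longrightarrow> x \<in> VS \<Longrightarrow> \<sigma> x = Some (\<tau> x)"
      "\<And>x. x \<in> RES - {v} \<Longrightarrow> x \<in> VD \<Longrightarrow> succs G x \<subseteq> RES \<union> T \<union> X"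
    and v: "v \<in> VS \<Longrightarrow> \<exists>u\<in>succs G v \<inter> (RES \<union> R). \<sigma> v = Some u"
      "v \<in> VD \<Longrightarrow> succs G v \<subseteq> RES \<union> R \<union> T \<union> X" "odd (P v)"
    and prio: "\<And>x. x \<in> RES \<union> R \<Longrightarrow> P v \<le> P x"
    and A: "attracting G Square W A (RES \<union> R) \<tau>'"
      "\<And>x. x \<in> A - (RES \<union> R) \<Longrightarrow> x \<in> VS \<Longrightarrow> \<sigma> x = Some (\<tau>' x)"
      "\<And>x. x \<in> A - (RES \<union> R) \<Longrightarrow> x \<in> VD \<Longrightarrow> succs G x \<subseteq> A \<union> T \<union> X"
  shows "dominion \<sigma> (T \<union> A) X"
proof -
  let ?D = "RES \<union> R"
  have \<tau>: "\<tau> x \<in> succs G x \<inter> RES" if "x \<in> RES - {v}" "x \<in> VS" for x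
    using RES(1) that unfolding attracting_def by blast
  have \<tau>': "\<tau>' x \<in> succs G x \<inter> A" if "x \<in> A - ?D" "x \<in> VS" for x
    using A(1) that unfolding attracting_def by blast
  \<comment> \<open>Exits of \<open>R\<close> lead into \<open>RES\<close> or outside
    \<open>W\<close>, and the moves considered at \<open>v\<close> return to the union or leave
    \<open>W\<close>.\<close>
  have D_step: "y \<in> ?D \<union> T \<union> X" if "x \<in> ?D" "y \<in> succs G x" "x \<in> VS \<Longrightarrow> \<sigma> x = Some y" for x y
  proof (cases "x \<in> R")
    case True
    then show ?thesis using dominion_step[OF R True that(2,3)] by blast
  next
    case False
    then have x: "x \<in> RES" "x \<in> V" using that sets by auto
    show ?thesis
    proof (cases "x \<in> VS")
      case True
      then show ?thesis
        using v(1) RES(3)[of x] \<tau>[of x] that(3) x by (cases "x = v") auto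
    next
      case False
      then show ?thesis
        using v(2) RES(4)[of x] that(2) x Square_iff by (cases "x = v") blast+
    qed
  qed
  have own: "\<exists>y\<in>succs G x \<inter> (T \<union> A \<union> X). \<sigma> x = Some y" if x: "x \<in> T \<union> A" "x \<in> VS" for x
  proof -
    consider "x \<in> T" | "x \<in> R" | "x \<in> RES" "x \<noteq> v" | "x = v" | "x \<in> A - ?D"
      using x by blast
    then show ?thesis
    proof cases
      case 1 then show ?thesis using T x(2) unfolding dominion_def by blast
    next
      case 2
      then obtain y where "y \<in> succs G x \<inter> (R \<union> (T \<union> X \<union> RES))" "\<sigma> x = Some y"
        using R x(2) unfolding dominion_def by blast
      then show ?thesis using sets(1) by blast
    next
      case 3 then show ?thesis using RES(3)[of x] \<tau>[of x] x(2) sets(1) by blast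
    next
      case 4 then show ?thesis using v(1) x(2) sets(1) by blast
    next
      case 5 then show ?thesis using A(2)[of x] \<tau>'[of x] x(2) by blast
    qed
  qed
  have opp: "succs G x \<subseteq> T \<union> A \<union> X" if x: "x \<in> T \<union> A" "x \<in> VD" for x
  proof -
    have nS: "x \<notin> VS" using x(2) owned_disj by blast
    consider "x \<in> T" | "x \<in> ?D" | "x \<in> A - ?D" using x by blast
    then show ?thesis
    proof cases
      case 1 then show ?thesis using T x(2) unfolding dominion_def by blast
    next
      case 2 then show ?thesis using D_step[OF 2] nS sets(1) by blast
    next
      case 3 then show ?thesis using A(3)[of x] x(2) by blast
    qed
  qed
  have win: "odd (min_inf \<pi>)"
    if in_TA: "\<And>i. \<pi> i \<in> T \<union> A" and edge: "\<And>i. \<pi> (Suc i) \<in> succs G (\<pi> i)"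
      and cons: "\<And>i. \<pi> i \<in> VS \<Longrightarrow> \<sigma> (\<pi> i) = Some (\<pi> (Suc i))" for \<pi>
  proof (cases "\<exists>n. \<pi> n \<in> T")
    case True
    then obtain n where n: "\<pi> n \<in> T" by blast
    have "\<pi> (n + i) \<in> T" for i
    proof (induction i)
      case (Suc i)
      have "\<pi> (Suc (n + i)) \<in> T \<union> X" using dominion_step[OF T Suc edge cons] .
      then show ?case using in_TA[of "Suc (n + i)"] sets by auto
    qed (simp add: n)
    then have "odd (min_inf (\<lambda>i. \<pi> (n + i)))"
      by (rule dominion_play[OF T]) (use edge cons in auto)
    then show ?thesis by (simp add: min_inf_shift)
  next
    case False
    then have in_A: "\<pi> i \<in> A" for i using in_TA by blast
    then have in_W: "\<pi> i \<in> W" for i using sets by blast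
    have "\<exists>n. \<pi> n \<in> ?D"
    proof (rule ccontr)
      assume no: "\<nexists>n. \<pi> n \<in> ?D"
      have "\<pi> (Suc i) = \<tau>' (\<pi> i)" if "\<pi> i \<in> VS" for i
        using cons[OF that] A(2)[of "\<pi> i"] in_A no that by auto
      then have "\<exists>i. \<pi> i \<in> ?D"
        using A(1) in_A in_W edge unfolding attracting_def by blast
      then show False using no by blast
    qed
    then obtain n where n: "\<pi> n \<in> ?D" by blast
    define \<xi> where "\<xi> i = \<pi> (n + i)" for i
    have \<xi>: "\<xi> (Suc i) \<in> succs G (\<xi> i)" "\<xi> i \<in> VS \<Longrightarrow> \<sigma> (\<xi> i) = Some (\<xi> (Suc i))" "\<xi> i \<in> W" for i
      using edge cons in_W by (auto simp: \<xi>_def)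
    have D: "\<xi> i \<in> ?D" for i
    proof (induction i)
      case 0
      then show ?case using n by (simp add: \<xi>_def)
    next
      case (Suc i)
      then show ?case using D_step[OF Suc \<xi>(1,2)] \<xi>(3)[of "Suc i"] sets(4) by blast
    qed
    have "odd (min_inf \<xi>)"
    proof (cases "\<exists>m. \<forall>i\<ge>m. \<xi> i \<in> R")
      case True
      then obtain m where "\<forall>i\<ge>m. \<xi> i \<in> R" by blast
      then have "\<xi> (m + i) \<in> R" for i by simp
      then have "odd (min_inf (\<lambda>i. \<xi> (m + i)))"
        by (rule dominion_play[OF R]) (use \<xi> in auto)
      then show ?thesis by (simp add: min_inf_shift)
    next
      case False
      \<comment> \<open>If \<open>v\<close> were avoided after \<open>m\<close>, the play from a
        later visit to \<open>RES\<close> would contradict that \<tau> attracts to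
        \<open>v\<close>.\<close>
      have "\<exists>j\<ge>m. \<xi> j = v" for m
      proof -
        obtain i where i: "i \<ge> m" "\<xi> i \<in> RES" using False D by blast
        show ?thesis
        proof (rule ccontr)
          assume no: "\<not> (\<exists>j\<ge>m. \<xi> j = v)"
          let ?\<pi> = "\<lambda>j. \<xi> (i + j)"
          have "?\<pi> (Suc j) = \<tau> (?\<pi> j)" if "?\<pi> j \<in> (RES - {v}) \<inter> VS" for j
            using \<xi>(2)[of "i + j"] RES(3)[of "?\<pi> j"] that by auto
          then have "\<exists>j. ?\<pi> j \<in> {v}"
            using RES(1) i(2) \<xi>(1,3) unfolding attracting_def
            by (elim conjE allE[where x = ?\<pi>]) auto
          then show False using no i(1) by (metis le_add1 le_trans singletonD)
        qed
      qed
      then have "infinite {j. P (\<xi> j) = P v}"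
        unfolding infinite_nat_iff_unbounded_le by (metis (mono_tags) mem_Collect_eq)
      then have "min_inf \<xi> = P v" by (rule min_inf_eqI) (use D prio in auto)
      then show ?thesis using v(3) by simp
    qed
    then show ?thesis unfolding \<xi>_def by (simp add: min_inf_shift)
  qed
  have "T \<union> A \<subseteq> V" using T sets unfolding dominion_def by blast
  then show ?thesis
    unfolding dominion_def using own opp win by blast
qed

text \<open>Without exits, a consistent play never leaves \<open>T\<close>. Legality is asked at
  every vertex of \<open>Square\<close>, because \<open>strategy\<close> is not limited to
  \<open>T\<close>.\<close>

lemma dominion_winning:
  assumes "dominion \<sigma> T {}" "\<And>x y. x \<in> VS \<Longrightarrow> \<sigma> x = Some y \<Longrightarrow> y \<in> succs G x"
  shows "winning_strategy_on G Square T \<sigma>"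
proof -
  have "odd (min_inf \<pi>)"
    if v: "v \<in> T" and p: "play G v \<pi>" and c: "consistent G Square (positional \<sigma>) \<pi>" for v \<pi>
  proof -
    have edge: "\<pi> (Suc i) \<in> succs G (\<pi> i)" for i using p by (simp add: play_def succs_def)
    have c': "\<pi> (Suc i) = w" if "\<pi> i \<in> VS" "\<sigma> (\<pi> i) = Some w" for i w
      using c that by (auto simp: consistent_def positional_def)
    have cons: "\<sigma> (\<pi> i) = Some (\<pi> (Suc i))" if "\<pi> i \<in> T" "\<pi> i \<in> VS" for i
      using c'[OF that(2)] assms(1) that unfolding dominion_def by auto
    have T: "\<pi> i \<in> T" for i
    proof (induction i)
      case 0 then show ?case using v p by (simp add: play_def)
    next
      case (Suc i) then show ?case using dominion_step[OF assms(1) Suc edge cons[OF Suc]] by simp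
    qed
    show ?thesis using assms(1) T edge cons[OF T] by (rule dominion_play)
  qed
  moreover have "strategy G Square (positional \<sigma>)"
    using assms(2) by (auto simp: strategy_def positional_def succs_def)
  moreover have "T \<inter> VS \<subseteq> dom \<sigma>"
    using assms(1) by (auto simp: dominion_def)
  ultimately show ?thesis
    unfolding winning_strategy_on_def winning_from_def by (simp add: won_by_iff del: won_by.simps)
qed

text \<open>Moving to a successor of least value keeps the progress condition along the play. If the
  least recurring priority were odd, the values truncated there would from some point on never grow
  and yet drop infinitely often, within a finite set.\<close>

lemma progress_winning:
  fixes \<rho> \<sigma>
  defines "N \<equiv> {v \<in> V. \<rho> v \<noteq> Top}"
  assumes prog: "\<And>x. x \<in> N \<Longrightarrow> sat_at \<rho> x (\<rho> x)"
    and \<sigma>: "dom \<sigma> = {v \<in> VD. \<rho> v \<noteq> Top}"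
      "\<And>v u. \<sigma> v = Some u \<Longrightarrow> u \<in> succs G v \<and> (\<forall>w\<in>succs G v. \<rho> u \<le> \<rho> w)"
  shows "winning_strategy_on G Diamond N \<sigma>"
proof -
  have "even (min_inf \<pi>)"
    if v: "v \<in> N" and p: "play G v \<pi>" and c: "consistent G Diamond (positional \<sigma>) \<pi>" for v \<pi>
  proof (rule ccontr)
    assume odd: "odd (min_inf \<pi>)"
    let ?p = "min_inf \<pi>"
    have edge: "\<pi> (Suc i) \<in> succs G (\<pi> i)" for i using p by (simp add: play_def succs_def)
    have c': "\<pi> (Suc i) = w" if "\<pi> i \<in> VD" "\<sigma> (\<pi> i) = Some w" for i w
      using c that by (auto simp: consistent_def positional_def)
    have ab: "above (P (\<pi> i)) (\<rho> (\<pi> i)) (\<rho> (\<pi> (Suc i)))" if Ni: "\<pi> i \<in> N" for i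
    proof (cases "\<pi> i \<in> VD")
      case True
      have "\<pi> i \<in> dom \<sigma>" using \<sigma>(1) True Ni by (simp add: N_def)
      then obtain u where u: "\<sigma> (\<pi> i) = Some u" by blast
      obtain w where "w \<in> succs G (\<pi> i)" "above (P (\<pi> i)) (\<rho> (\<pi> i)) (\<rho> w)"
        using prog[OF Ni] True by (auto simp: sat_at_def)
      moreover have "\<rho> u \<le> \<rho> w" if "w \<in> succs G (\<pi> i)" for w using \<sigma>(2)[OF u] that by blast
      ultimately show ?thesis using above_mono trunc_mono c'[OF True u] by blast
    next
      case False
      then show ?thesis using prog[OF Ni] edge by (auto simp: sat_at_def)
    qed
    have N: "\<pi> i \<in> N" for i
    proof (induction i)
      case 0 then show ?case using v p by (simp add: play_def)
    next
      case (Suc i)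
      then show ?case using above_not_Top[OF ab[OF Suc]] edge succs_sub by (auto simp: N_def)
    qed
    obtain n where n: "\<And>i. i \<ge> n \<Longrightarrow> ?p \<le> P (\<pi> i)" using min_inf_eventually by blast
    let ?g = "\<lambda>i. trunc ?p (\<rho> (\<pi> i))"
    have step: "?g (Suc i) \<le> ?g i" if "i \<ge> n" for i
      using trunc_mono_le[OF n[OF that] above_trunc_le[OF ab[OF N]]] .
    have anti: "?g (i + j) \<le> ?g i" if "i \<ge> n" for i j
    proof (induction j)
      case (Suc j)
      then show ?case using order_trans[OF step[of "i + j"] Suc] that by simp
    qed simp
    have "?g ` {n..} \<subseteq> (\<lambda>x. trunc ?p (\<rho> x)) ` V" using N by (auto simp: N_def)
    then have fin: "finite (?g ` {n..})" by (rule finite_subset) simp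
    have "Min (?g ` {n..}) \<in> ?g ` {n..}" by (rule Min_in[OF fin]) auto
    \<comment> \<open>From an index beyond \<open>n\<close> with least truncated value, any later
      drop is contradictory.\<close>
    then obtain m where m: "m \<ge> n" "?g m = Min (?g ` {n..})" by auto
    have min: "?g m \<le> ?g i" if "i \<ge> n" for i
      unfolding m(2) using fin that by (intro Min_le) auto
    have "\<pi> i \<in> V" for i using N by (auto simp: N_def)
    then obtain j where j: "j \<ge> m" "P (\<pi> j) = ?p"
      using min_inf_infinite[of \<pi>] unfolding infinite_nat_iff_unbounded_le by blast
    have "?g (Suc j) < ?g j"
      using ab[OF N, of j] odd N j(2) by (auto simp: above_def N_def)
    also have "?g j \<le> ?g m" using anti[OF m(1), of "j - m"] j(1) by simp
    finally show False using min[of "Suc j"] j(1) m(1) by simp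
  qed
  moreover have "strategy G Diamond (positional \<sigma>)"
    using \<sigma>(2) by (auto simp: strategy_def positional_def succs_def)
  moreover have "N \<inter> VD \<subseteq> dom \<sigma>"
    using \<sigma>(1) by (auto simp: N_def)
  ultimately show ?thesis
    unfolding winning_strategy_on_def winning_from_def by (simp add: won_by_iff del: won_by.simps)
qed

text \<open>The two sets cover \<open>V\<close> and no vertex is winning for both players, so
  neither region can be larger.\<close>

lemma winning_regions:
  assumes "winning_strategy_on G Diamond {v \<in> V. \<rho> v \<noteq> Top} \<sigma>\<^sub>D"
    "winning_strategy_on G Square {v \<in> V. \<rho> v = Top} \<sigma>\<^sub>S"
  shows "winning_region G Diamond = {v \<in> V. \<rho> v \<noteq> Top}"
    "winning_region G Square = {v \<in> V. \<rho> v = Top}"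
  using assms not_both_winning unfolding winning_strategy_on_def winning_region_def by blast+

section \<open>Invariants of the algorithm\<close>

text \<open>An activation of the procedure called with \<open>W0\<close> whose variable now has the value \<open>W\<close>.\<close>

definition active :: "'v set \<Rightarrow> 'v set \<Rightarrow> ('v \<Rightarrow> 'v option) \<Rightarrow> ('v \<Rightarrow> measure) \<Rightarrow> bool" where
  "active W0 W \<sigma> \<rho> \<longleftrightarrow> W \<subseteq> W0 \<and> W0 \<subseteq> V \<and> (\<forall>x\<in>W0 - W. \<rho> x = Top) \<and>
     dominion \<sigma> (W0 - W) {x \<in> V - W0. \<rho> x = Top} \<and> region \<rho> W"

text \<open>The invariant of an activation reads \<sigma> and \<rho> only outside
  \<open>W\<close>.\<close>

lemma active_cong:
  assumes "active W0 W \<sigma> \<rho>" "\<And>x. x \<notin> W \<Longrightarrow> \<sigma>' x = \<sigma> x" "\<And>x. x \<notin> W \<Longrightarrow> \<rho>' x = \<rho> x"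
  shows "active W0 W \<sigma>' \<rho>'"
proof -
  have W: "W \<subseteq> W0" using assms(1) by (simp add: active_def)
  then have "\<rho>' x = \<rho> x" if "x \<notin> W0" for x using assms(3) that by blast
  then have "{x \<in> V - W0. \<rho>' x = Top} = {x \<in> V - W0. \<rho> x = Top}" by auto
  moreover have "dominion \<sigma>' (W0 - W) X = dominion \<sigma> (W0 - W) X" for X
    by (rule dominion_cong) (use assms(2) in auto)
  moreover have "region \<rho>' W = region \<rho> W"
    unfolding region_def using assms(3) by simp
  ultimately show ?thesis using assms(1,3) unfolding active_def by simp
qed

text \<open>\<open>\<rho>0\<close> is the temporary measure at the time of the recursive call on \<open>REM\<close>.\<close>

definition suspended ::
    "'v set \<Rightarrow> 'v set \<Rightarrow> 'v set \<Rightarrow> ('v \<Rightarrow> 'v option) \<Rightarrow> ('v \<Rightarrow> measure) \<Rightarrow> bool" where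
  "suspended W RES REM \<sigma> \<rho> \<longleftrightarrow> (\<exists>v \<tau> \<rho>0 IRR. v \<in> W \<and> odd (P v) \<and>
     RES = guarded_attractor G (P v) W {v} \<and> IRR = attractor G Diamond W {w \<in> W. P w < P v} \<and>
     REM = W - (RES \<union> IRR) \<and> RES \<inter> IRR = {} \<and>
     attracting G Square W RES {v} \<tau> \<and> (\<forall>x\<in>RES - {v}. x \<in> VS \<longrightarrow> \<sigma> x = Some (\<tau> x)) \<and>
     (\<forall>x\<in>RES. \<rho> x = Top) \<and> (\<forall>x\<in>IRR. \<rho> x \<noteq> Top) \<and> reachable \<rho>0 \<and>
     (\<forall>x\<in>REM. x \<in> VS \<longrightarrow> (\<forall>y\<in>succs G x - REM. \<rho>0 y \<le> tup (slack (insert v REM)))) \<and>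
     (v \<in> VS \<longrightarrow> (\<exists>u\<in>succs G v \<inter> (W - IRR). \<sigma> v = Some u \<and> full (P v) (\<rho>0 u))) \<and>
     (v \<in> VD \<longrightarrow> (\<forall>u\<in>succs G v \<inter> W. u \<notin> IRR \<and> full (P v) (\<rho>0 u))))"

lemma guarded_attractor_self: "v \<in> guarded_attractor G k W {v}"
  by (simp add: attr.target)

lemma guarded_attractor_subset: "v \<in> W \<Longrightarrow> guarded_attractor G k W {v} \<subseteq> W"
  using attr_subset[of G Square W "{v \<in> W. k \<le> P v}" "{v}"] by auto

lemma attractor_subset: "U \<subseteq> W \<Longrightarrow> attractor G p W U \<subseteq> W"
  using attr_subset[of G p W W U] by auto

lemma suspended_cong:
  assumes "suspended W RES REM \<sigma> \<rho>" "\<And>x. x \<notin> REM \<Longrightarrow> \<sigma>' x = \<sigma> x" "\<And>x. x \<notin> REM \<Longrightarrow> \<rho>' x = \<rho> x"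
  shows "suspended W RES REM \<sigma>' \<rho>'"
proof -
  obtain v \<tau> \<rho>0 IRR where s: "v \<in> W" "odd (P v)" "RES = guarded_attractor G (P v) W {v}"
     "IRR = attractor G Diamond W {w \<in> W. P w < P v}"
     "REM = W - (RES \<union> IRR)" "RES \<inter> IRR = {}" "attracting G Square W RES {v} \<tau>"
     "\<forall>x\<in>RES - {v}. x \<in> VS \<longrightarrow> \<sigma> x = Some (\<tau> x)"
     "\<forall>x\<in>RES. \<rho> x = Top" "\<forall>x\<in>IRR. \<rho> x \<noteq> Top" "reachable \<rho>0"
     "\<forall>x\<in>REM. x \<in> VS \<longrightarrow> (\<forall>y\<in>succs G x - REM. \<rho>0 y \<le> tup (slack (insert v REM)))"
     "v \<in> VS \<longrightarrow> (\<exists>u\<in>succs G v \<inter> (W - IRR). \<sigma> v = Some u \<and> full (P v) (\<rho>0 u))"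
     "v \<in> VD \<longrightarrow> (\<forall>u\<in>succs G v \<inter> W. u \<notin> IRR \<and> full (P v) (\<rho>0 u))"
    using assms(1)[unfolded suspended_def] by (elim exE conjE) (rule that)
  have "x \<notin> REM" if "x \<in> RES \<union> IRR" for x using that s(5) by blast
  then have eq: "\<sigma>' x = \<sigma> x" "\<rho>' x = \<rho> x" if "x \<in> RES \<union> IRR" for x using that assms(2,3) by blast+
  have "v \<in> RES" unfolding s(3) by (rule guarded_attractor_self)
  then have "\<sigma>' v = \<sigma> v" using eq by blast
  moreover have "\<forall>x\<in>RES - {v}. x \<in> VS \<longrightarrow> \<sigma>' x = Some (\<tau> x)" "\<forall>x\<in>RES. \<rho>' x = Top" "\<forall>x\<in>IRR. \<rho>' x \<noteq> Top"
    using s(8,9,10) eq by simp_all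
  ultimately show ?thesis
    unfolding suspended_def using s(1-7,11-14) by (intro exI[of _ v] exI[of _ \<tau>] exI[of _ \<rho>0] exI[of _ IRR]) simp
qed

text \<open>\<open>W0\<close> is the argument of the call above the listed frames: the
  \<open>REM\<close> of the frame waiting for it, or all of \<open>V\<close> at the bottom. Only the
  topmost frame of a configuration can be \<open>Within\<close>, and it is not passed on to
  \<open>stack\<close>.\<close>

fun stack :: "'v frame list \<Rightarrow> 'v set \<Rightarrow> ('v \<Rightarrow> 'v option) \<Rightarrow> ('v \<Rightarrow> measure) \<Rightarrow> bool" where
  "stack [] W0 \<sigma> \<rho> \<longleftrightarrow> W0 = V"
| "stack (Resume W RES REM # fs) W0 \<sigma> \<rho> \<longleftrightarrow> W0 = REM \<and> suspended W RES REM \<sigma> \<rho> \<and>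
     (\<exists>W1. active W1 W \<sigma> \<rho> \<and> stack fs W1 \<sigma> \<rho>)"
| "stack (Within W # fs) W0 \<sigma> \<rho> \<longleftrightarrow> False"

lemma suspended_subset:
  assumes "suspended W RES REM \<sigma> \<rho>"
  shows "REM \<subseteq> W" "RES \<subseteq> W"
  using assms[unfolded suspended_def]
  by (elim exE conjE, simp add: guarded_attractor_subset Diff_subset)+

text \<open>A call alters \<sigma> and \<rho> only inside its argument, so the waiting frames keep
  their invariants.\<close>

lemma stack_cong:
  assumes "stack fs W0 \<sigma> \<rho>" "\<And>x. x \<notin> W0 \<Longrightarrow> \<sigma>' x = \<sigma> x" "\<And>x. x \<notin> W0 \<Longrightarrow> \<rho>' x = \<rho> x"
  shows "stack fs W0 \<sigma>' \<rho>'"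
  using assms
proof (induction fs W0 \<sigma> \<rho> rule: stack.induct)
  case (2 W RES REM fs W0 \<sigma> \<rho>)
  then obtain W1 where W1: "W0 = REM" "suspended W RES REM \<sigma> \<rho>" "active W1 W \<sigma> \<rho>" "stack fs W1 \<sigma> \<rho>"
    by auto
  have sub: "REM \<subseteq> W" "W \<subseteq> W1" using suspended_subset W1 by (auto simp: active_def)
  have off: "\<sigma>' x = \<sigma> x" "\<rho>' x = \<rho> x" if "x \<notin> REM" for x
    using 2 W1(1) that by auto
  have "suspended W RES REM \<sigma>' \<rho>'"
    by (rule suspended_cong[OF W1(2)]) (fact off)+
  moreover have "active W1 W \<sigma>' \<rho>'"
    by (rule active_cong[OF W1(3)]) (use sub in \<open>blast intro: off\<close>)+
  moreover have "stack fs W1 \<sigma>' \<rho>'"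
    by (rule "2.IH"[OF W1(4)]) (use sub in \<open>blast intro: off\<close>)+
  ultimately show ?case using W1(1) by auto
qed auto

definition legal :: "('v \<Rightarrow> 'v option) \<Rightarrow> bool" where
  "legal \<sigma> \<longleftrightarrow> (\<forall>x y. x \<in> VS \<longrightarrow> \<sigma> x = Some y \<longrightarrow> y \<in> succs G x)"

definition final :: "('v \<Rightarrow> measure) \<Rightarrow> 'v set \<Rightarrow> bool" where
  "final \<rho> W \<longleftrightarrow> (\<forall>x\<in>W. \<rho> x \<noteq> Top \<and> up \<rho> x \<le> \<rho> x)"

definition fresh :: "('v \<Rightarrow> measure) \<Rightarrow> 'v set \<Rightarrow> bool" where
  "fresh \<rho> W \<longleftrightarrow> (\<forall>v\<in>W. \<rho> v = Top \<longrightarrow> just_lifted \<rho> v \<and> (\<forall>w\<in>W. \<rho> w = Top \<longrightarrow> w = v))"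

text \<open>The second equation describes the moment after a return: \<open>W\<close> is what the
  finished call left over, and \<open>W0\<close> is its argument.\<close>

fun inv_stack :: "'v frame list \<Rightarrow> ('v \<Rightarrow> 'v option) \<Rightarrow> ('v \<Rightarrow> measure) \<Rightarrow> bool" where
  "inv_stack (Within W # fs) \<sigma> \<rho> \<longleftrightarrow> (\<exists>W0. active W0 W \<sigma> \<rho> \<and> stack fs W0 \<sigma> \<rho> \<and> fresh \<rho> W)"
| "inv_stack fs \<sigma> \<rho> \<longleftrightarrow> (\<exists>W0 W. active W0 W \<sigma> \<rho> \<and> stack fs W0 \<sigma> \<rho> \<and> final \<rho> W)"

fun config_inv :: "'v config \<Rightarrow> bool" where
  "config_inv Start \<longleftrightarrow> True"
| "config_inv (Running fs \<sigma> \<rho>) \<longleftrightarrow> reachable \<rho> \<and> legal \<sigma> \<and> inv_stack fs \<sigma> \<rho>"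
| "config_inv (Done (U\<^sub>D, \<sigma>\<^sub>D) (U\<^sub>S, \<sigma>\<^sub>S)) \<longleftrightarrow> U\<^sub>D = winning_region G Diamond \<and> U\<^sub>S = winning_region G Square \<and>
     winning_strategy_on G Diamond U\<^sub>D \<sigma>\<^sub>D \<and> winning_strategy_on G Square U\<^sub>S \<sigma>\<^sub>S"

section \<open>Preservation of the invariant\<close>

lemma inv_stack_returned:
  "stack fs W0 \<sigma> \<rho> \<Longrightarrow> inv_stack fs \<sigma> \<rho> \<longleftrightarrow> (\<exists>W0 W. active W0 W \<sigma> \<rho> \<and> stack fs W0 \<sigma> \<rho> \<and> final \<rho> W)"
  by (cases "(fs, W0, \<sigma>, \<rho>)" rule: stack.cases) auto

text \<open>The chosen \<open>u\<close> is full by maximality, whereas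
  \<open>irrelevant_bound\<close> limits the values in \<open>IRR\<close>; hence \<open>u\<close>
  lies outside \<open>IRR\<close>. The same limit accounts for the exits of \<open>Square\<close>
  from \<open>REM\<close>, which is therefore again a region. The measure \<rho> before the step is
  the witness for \<open>\<rho>0\<close>.\<close>

lemma top_step:
  assumes reach: "reachable \<rho>" and legal: "legal \<sigma>" and reg: "region \<rho> W"
    and v: "v \<in> W" and top: "\<And>w. w \<in> W \<Longrightarrow> \<rho> w = Top \<longleftrightarrow> w = v" and jl: "just_lifted \<rho> v"
    and u: "u \<in> succs G v \<inter> W" "\<And>u'. u' \<in> succs G v \<inter> W \<Longrightarrow> trunc (P v) (\<rho> u') \<le> trunc (P v) (\<rho> u)"
    and RES: "RES = guarded_attractor G (P v) W {v}" and \<tau>: "attracting G Square W RES {v} \<tau>"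
    and IRR: "IRR = attractor G Diamond W {w \<in> W. P w < P v}" and REM: "REM = W - (RES \<union> IRR)"
  defines "\<sigma>' \<equiv> record_moves ((RES - {v}) \<inter> VS) \<tau> (\<sigma>(v \<mapsto> u))"
    and "\<rho>' \<equiv> set_top (RES - {v}) \<rho>"
  shows "reachable \<rho>'" "legal \<sigma>'" "suspended W RES REM \<sigma>' \<rho>'" "region \<rho>' REM"
    "\<And>x. x \<in> REM \<Longrightarrow> \<rho>' x \<noteq> Top"
proof -
  let ?k = "P v"
  have WV: "W \<subseteq> V" using regionD(1)[OF reg] .
  have odd: "odd ?k" using jl by (simp add: just_lifted_def)
  have vV: "v \<in> V" using v WV by auto
  have vRES: "v \<in> RES" unfolding RES by (rule guarded_attractor_self)
  have RESW: "RES \<subseteq> W" unfolding RES using guarded_attractor_subset[OF v] .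
  have IRRW: "IRR \<subseteq> W" unfolding IRR by (rule attractor_subset) auto
  have vIRR: "v \<notin> IRR" and IRRb: "\<And>y. y \<in> IRR \<Longrightarrow> \<rho> y \<le> tup (slack (W - IRR))"
    unfolding IRR using irrelevant_bound[OF reach reg v top jl] by simp_all
  have prioRES: "?k \<le> P x" if "x \<in> RES" for x
    using that attr_subset[of G Square W "{w \<in> W. ?k \<le> P w}" "{v}"] unfolding RES by auto
  have prioREM: "?k \<le> P x" if "x \<in> W - IRR" for x
    using that attr.target[of x "{w \<in> W. P w < ?k}" G Diamond W W] unfolding IRR by force
  \<comment> \<open>A vertex of \<open>RES\<close> other than \<open>v\<close> keeps all its moves
    within \<open>W\<close> (for \<open>Diamond\<close>) or one of them (for \<open>Square\<close>)
    inside \<open>RES\<close>, which contradicts its attraction to \<open>IRR\<close>.\<close>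
  have disj: "x \<notin> RES" if "x \<in> IRR" for x
    using that unfolding IRR
  proof induction
    case (target x)
    then show ?case using prioRES by fastforce
  next
    case (own x w)
    have "w \<in> W" using own.hyps(4) IRRW unfolding IRR by blast
    show ?case
    proof
      assume x: "x \<in> RES"
      have "x \<noteq> v" using vIRR attr.own[OF own.hyps] unfolding IRR by blast
      then have "succs G x \<inter> W \<subseteq> RES"
        using attr_cases(2)[OF x[unfolded RES]] own.hyps(2) owned_disj unfolding RES by auto
      then show False using own.hyps(3) \<open>w \<in> W\<close> own.IH by blast
    qed
  next
    case (opp x)
    show ?case
    proof
      assume x: "x \<in> RES"
      have "x \<noteq> v" using vIRR attr.opp[OF opp.hyps(1-3)] unfolding IRR by blast
      then have "succs G x \<inter> RES \<noteq> {}"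
        using attr_cases(2)[OF x[unfolded RES]] opp.hyps(2) owned_disj unfolding RES by auto
      then show False using opp.IH RESW by blast
    qed
  qed
  have IRR_top: "\<rho> x \<noteq> Top" if "x \<in> IRR" for x
    using that vIRR top IRRW by blast
  have REMsub: "insert v REM \<subseteq> W - IRR" using v vIRR REM by auto
  have REM_VD: "y \<in> REM \<or> \<rho>' y = Top" if "x \<in> REM" "x \<in> VD" "y \<in> succs G x" for x y
  proof -
    have "y \<notin> IRR"
      using that attr.own[of x W G Diamond y W "{w \<in> W. P w < ?k}"] unfolding REM IRR by blast
    moreover have "\<rho>' y = Top" if "y \<in> RES" using that top v by (auto simp: \<rho>'_def set_top_def)
    moreover have "\<rho>' y = Top" if "y \<notin> W"
      using that regionD(3)[OF reg] \<open>x \<in> REM\<close> \<open>x \<in> VD\<close> \<open>y \<in> succs G x\<close> unfolding REM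
      by (auto simp: \<rho>'_def set_top_def)
    ultimately show ?thesis unfolding REM by blast
  qed
  \<comment> \<open>Vertices of \<open>REM\<close> have priority at least \<open>P v\<close>, so the
    guard of the attractor does not exclude them.\<close>
  have REM_VS_RES: "y \<notin> RES" if "x \<in> REM" "x \<in> VS" "y \<in> succs G x" for x y
    using that attr.own[of x "{w \<in> W. ?k \<le> P w}" G Square y W "{v}"] prioREM[of x]
    unfolding REM RES by blast
  have REM_VS: "\<rho> y \<le> tup (slack (insert v REM))" "\<rho>' y = \<rho> y"
    if "x \<in> REM" "x \<in> VS" "y \<in> succs G x" "y \<notin> REM" for x y
  proof -
    have y: "y \<notin> RES" using REM_VS_RES that by blast
    then show "\<rho>' y = \<rho> y" by (simp add: \<rho>'_def set_top_def)
    have "\<rho> y \<le> tup (slack (W - IRR))"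
    proof (cases "y \<in> W")
      case True
      then show ?thesis using IRRb that(4) y unfolding REM by blast
    next
      case False
      then have "\<rho> y \<le> tup (slack W)" using regionD(4)[OF reg] that unfolding REM by blast
      then show ?thesis using slack_mono_tup[of "W - IRR" W] WV by (auto intro: order_trans)
    qed
    then show "\<rho> y \<le> tup (slack (insert v REM))"
      using slack_mono_tup[OF REMsub] WV by (auto intro: order_trans)
  qed
  \<comment> \<open>A vertex of \<open>REM\<close> without successor in \<open>REM\<close> would
    have been attracted to \<open>RES\<close> or to \<open>IRR\<close>.\<close>
  have succ_REM: "succs G x \<inter> REM \<noteq> {}" if "x \<in> REM" for x
  proof (cases "x \<in> VD")
    case True
    have "\<not> succs G x \<inter> W \<subseteq> RES"
      using that True attr.opp[of x "{w \<in> W. ?k \<le> P w}" G Square W "{v}"] prioREM[of x]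
      unfolding REM RES by (auto simp: subset_iff)
    then obtain y where y: "y \<in> succs G x" "y \<in> W" "y \<notin> RES" by blast
    have "y \<notin> IRR"
      using that True y(1) attr.own[of x W G Diamond y W "{w \<in> W. P w < ?k}"] unfolding REM IRR by blast
    then show ?thesis using y unfolding REM by blast
  next
    case False
    then have x: "x \<in> VS" using Square_iff that WV unfolding REM by blast
    have "\<not> succs G x \<inter> W \<subseteq> IRR"
      using that x attr.opp[of x W G Diamond W "{w \<in> W. P w < ?k}"]
      unfolding REM IRR by (auto simp: subset_iff)
    then obtain y where "y \<in> succs G x" "y \<in> W" "y \<notin> IRR" by blast
    then show ?thesis using REM_VS_RES[OF that x] unfolding REM by blast
  qed
  show reach': "reachable \<rho>'"
    unfolding \<rho>'_def RES
    by (rule reachable_set_top[OF reach WV]) (use v top regionD(3)[OF reg] in auto)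
  show no_top: "\<rho>' x \<noteq> Top" if "x \<in> REM" for x
    using that top vRES unfolding REM by (auto simp: \<rho>'_def set_top_def)
  show "region \<rho>' REM"
    unfolding region_def
  proof (intro conjI ballI impI)
    show "REM \<subseteq> V" using WV REM by auto
    show "succs G x \<inter> REM \<noteq> {}" if "x \<in> REM" for x using succ_REM[OF that] .
    show "\<rho>' y = Top" if "x \<in> REM" "x \<in> VD" "y \<in> succs G x - REM" for x y
      using REM_VD that by blast
    show "\<rho>' y \<le> tup (slack REM)" if "x \<in> REM" "x \<in> VS" "y \<in> succs G x - REM" for x y
    proof -
      have "tup (slack (insert v REM)) \<le> tup (slack REM)"
        using REM WV vV by (intro slack_mono_tup) auto
      then show ?thesis using REM_VS that by (metis DiffE order_trans)
    qed
  qed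
  show "legal \<sigma>'"
    using legal \<tau> u(1) unfolding legal_def \<sigma>'_def record_moves_def attracting_def by auto
  have nfull: "x \<notin> IRR" if "full ?k (\<rho> x)" for x
    using that IRRb not_full_if_le_slack[of v "W - IRR" "\<rho> x"] v vIRR WV odd by blast
  have "\<exists>y\<in>succs G v \<inter> W. full ?k (\<rho> y)"
  proof (cases "v \<in> VD")
    case True
    then show ?thesis using jl u(1) by (auto simp: just_lifted_def)
  next
    case False
    then obtain y where y: "y \<in> succs G v" "full ?k (\<rho> y)" using jl by (auto simp: just_lifted_def)
    \<comment> \<open>A successor outside \<open>W\<close> is bounded by
      \<open>tup (slack W)\<close> and hence not full, as \<open>v\<close> lies in
      \<open>W\<close>.\<close>
    have "y \<in> W"
      using regionD(4)[OF reg v _ y(1)] not_full_if_le_slack[OF v WV odd] y(2) False Square_iff[OF vV]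
      by blast
    then show ?thesis using y by blast
  qed
  then have full_u: "full ?k (\<rho> u)" using u(2) order_trans unfolding full_def by blast
  have VS_v: "\<exists>u\<in>succs G v \<inter> (W - IRR). \<sigma>' v = Some u \<and> full ?k (\<rho> u)"
    using u(1) full_u nfull by (auto simp: \<sigma>'_def record_moves_def)
  have VD_v: "\<forall>u\<in>succs G v \<inter> W. u \<notin> IRR \<and> full ?k (\<rho> u)" if "v \<in> VD"
    using jl that nfull by (auto simp: just_lifted_def)
  have RES_top: "\<forall>x\<in>RES. \<rho>' x = Top" using top v by (auto simp: \<rho>'_def set_top_def)
  have IRR_top': "\<forall>x\<in>IRR. \<rho>' x \<noteq> Top" using IRR_top disj by (auto simp: \<rho>'_def set_top_def)
  have str: "\<forall>x\<in>RES - {v}. x \<in> VS \<longrightarrow> \<sigma>' x = Some (\<tau> x)"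
    by (auto simp: \<sigma>'_def record_moves_def)
  show "suspended W RES REM \<sigma>' \<rho>'"
    unfolding suspended_def
  proof (intro exI conjI)
    show "RES \<inter> IRR = {}" using disj by blast
    show "\<forall>x\<in>REM. x \<in> VS \<longrightarrow> (\<forall>y\<in>succs G x - REM. \<rho> y \<le> tup (slack (insert v REM)))"
      using REM_VS(1) by blast
    show "v \<in> VS \<longrightarrow> (\<exists>u\<in>succs G v \<inter> (W - IRR). \<sigma>' v = Some u \<and> full ?k (\<rho> u))"
      using VS_v by blast
    show "v \<in> VD \<longrightarrow> (\<forall>u\<in>succs G v \<inter> W. u \<notin> IRR \<and> full ?k (\<rho> u))"
      using VD_v by blast
  qed (fact v odd RES IRR REM \<tau> str RES_top IRR_top' reach)+
qed

text \<open>The vertices of \<open>REM\<close> that survive the recursive call carry a final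
  measure, so by \<open>final_bound\<close> none of them was full at the time of the call. The
  successor chosen at \<open>v\<close>, or every successor in \<open>W\<close> if
  \<open>Diamond\<close> owns \<open>v\<close>, was full and hence lies in \<open>DOM\<close>, so
  \<open>dominion_resume\<close> applies.\<close>

lemma resume_step:
  assumes reach: "reachable \<rho>" and legal: "legal \<sigma>" and sus: "suspended W RES REM \<sigma> \<rho>"
    and act: "active W0 W \<sigma> \<rho>" and ret: "active REM N \<sigma> \<rho>" "final \<rho> N"
    and DOM: "DOM = RES \<union> {w \<in> REM. \<rho> w = Top}"
    and A: "A = attractor G Square W DOM" and \<tau>': "attracting G Square W A DOM \<tau>'"
  defines "\<sigma>' \<equiv> record_moves ((A - DOM) \<inter> VS) \<tau>' \<sigma>" and "\<rho>' \<equiv> set_top (A - DOM) \<rho>"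
  shows "reachable \<rho>'" "legal \<sigma>'" "active W0 (W - A) \<sigma>' \<rho>'" "\<And>x. x \<in> W - A \<Longrightarrow> \<rho>' x \<noteq> Top"
proof -
  obtain v \<tau> \<rho>0 IRR where s: "v \<in> W" "odd (P v)" "RES = guarded_attractor G (P v) W {v}"
     "IRR = attractor G Diamond W {w \<in> W. P w < P v}"
     "REM = W - (RES \<union> IRR)" "RES \<inter> IRR = {}" "attracting G Square W RES {v} \<tau>"
    and \<tau>: "\<forall>x\<in>RES - {v}. x \<in> VS \<longrightarrow> \<sigma> x = Some (\<tau> x)"
    and RES_top: "\<forall>x\<in>RES. \<rho> x = Top" and IRR_top: "\<forall>x\<in>IRR. \<rho> x \<noteq> Top" and reach0: "reachable \<rho>0"
    and exits: "\<forall>x\<in>REM. x \<in> VS \<longrightarrow> (\<forall>y\<in>succs G x - REM. \<rho>0 y \<le> tup (slack (insert v REM)))"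
    and VS_v: "v \<in> VS \<longrightarrow> (\<exists>u\<in>succs G v \<inter> (W - IRR). \<sigma> v = Some u \<and> full (P v) (\<rho>0 u))"
    and VD_v: "v \<in> VD \<longrightarrow> (\<forall>u\<in>succs G v \<inter> W. u \<notin> IRR \<and> full (P v) (\<rho>0 u))"
    using sus[unfolded suspended_def] by (elim exE conjE) (rule that)
  have reg: "region \<rho> W" and WV: "W \<subseteq> V" and W0: "W \<subseteq> W0" "W0 \<subseteq> V"
    using act regionD(1) by (auto simp: active_def)
  have regN: "region \<rho> N" and N: "N \<subseteq> REM" and outN: "\<And>x. x \<in> REM - N \<Longrightarrow> \<rho> x = Top"
    using ret(1) by (auto simp: active_def)
  have vRES: "v \<in> RES" unfolding s(3) by (rule guarded_attractor_self)
  have RESW: "RES \<subseteq> W" unfolding s(3) using guarded_attractor_subset[OF s(1)] .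
  have IRRW: "IRR \<subseteq> W" unfolding s(4) by (rule attractor_subset) auto
  have NT: "\<rho> x \<noteq> Top" "up \<rho> x \<le> \<rho> x" if "x \<in> N" for x
    using ret(2) that by (auto simp: final_def)
  have DOM': "DOM = RES \<union> (REM - N)" using DOM NT N outN by auto
  have DOMW: "DOM \<subseteq> W" using DOM' RESW s(5) by auto
  have AW: "A \<subseteq> W" unfolding A using DOMW by (rule attractor_subset)
  have DOMA: "DOM \<subseteq> A" unfolding A by (auto intro: attr.target)
  have DOM_top: "\<rho> x = Top" if "x \<in> DOM" for x using that DOM RES_top by auto
  have A_top: "\<rho>' x = Top" if "x \<in> A" for x
    using that DOM_top by (auto simp: \<rho>'_def set_top_def)
  have not_A: "\<rho>' x = \<rho> x" "\<sigma>' x = \<sigma> x" if "x \<notin> A - DOM" for x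
    using that by (auto simp: \<rho>'_def set_top_def \<sigma>'_def record_moves_def)
  \<comment> \<open>Taking \<open>insert v REM\<close> for \<open>S\<close> withholds the slot of
    \<open>v\<close> from the count.\<close>
  have nfull: "\<not> full (P v) (\<rho>0 y)" if "y \<in> N" for y
  proof (rule final_bound[OF reach0, where N = N and S = "insert v REM" and \<rho>' = \<rho>])
    show "insert v REM \<subseteq> V" "N \<subseteq> insert v REM" "v \<notin> N" using N s(1,5) WV vRES by auto
    show "sat_at \<rho> x (\<rho> x)" if "x \<in> N" for x
      using up_le_iff[of x "\<rho> x" \<rho>] NT that regionD(1)[OF regN] reach by (auto simp: reachable_def)
    show "\<rho> y = Top" if "x \<in> N" "x \<in> VD" "y \<in> succs G x" "y \<notin> N" for x y
      using regionD(3)[OF regN that] .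
    show "\<rho> y = Top \<or> \<rho>0 y \<le> tup (slack (insert v REM))"
      if "x \<in> N" "x \<in> VS" "y \<in> succs G x" "y \<notin> N" for x y
      using that exits N outN by (cases "y \<in> REM") blast+
  qed (use NT s(2) that in auto)
  have in_DOM: "y \<in> DOM" if "y \<in> W - IRR" "full (P v) (\<rho>0 y)" for y
    using nfull that unfolding DOM' s(5) by blast
  show "reachable \<rho>'"
    unfolding \<rho>'_def A
    by (rule reachable_set_top[OF reach WV]) (use DOMW DOM_top regionD(3)[OF reg] in auto)
  show "legal \<sigma>'"
    using legal \<tau>' unfolding legal_def \<sigma>'_def record_moves_def attracting_def by auto
  show no_top: "\<rho>' x \<noteq> Top" if "x \<in> W - A" for x
  proof -
    have "x \<in> N \<union> IRR" using that DOMA unfolding DOM' s(5) by blast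
    then have "\<rho> x \<noteq> Top" using NT IRR_top by blast
    then show ?thesis using not_A that by simp
  qed
  have VS_A: "y \<notin> A" if "x \<in> W - A" "x \<in> VS" "y \<in> succs G x" for x y
    using that attr.own[of x W G Square y W DOM] unfolding A by blast
  have reg': "region \<rho>' (W - A)"
    unfolding region_def
  proof (intro conjI ballI impI)
    show "W - A \<subseteq> V" using WV by auto
    show "succs G x \<inter> (W - A) \<noteq> {}" if x: "x \<in> W - A" for x
    proof (cases "x \<in> VD")
      case True
      then have "\<not> succs G x \<inter> W \<subseteq> A"
        using x attr.opp[of x W G Square W DOM] unfolding A by (auto simp: subset_iff)
      then show ?thesis by blast
    next
      case False
      then have "x \<in> VS" using x WV Square_iff by blast
      then show ?thesis using VS_A[OF x] regionD(2)[OF reg, of x] x by blast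
    qed
    show "\<rho>' y = Top" if "x \<in> W - A" "x \<in> VD" "y \<in> succs G x - (W - A)" for x y
      using that regionD(3)[OF reg, of x y] A_top not_A(1)[of y] by (cases "y \<in> A") auto
    show "\<rho>' y \<le> tup (slack (W - A))" if x: "x \<in> W - A" "x \<in> VS" "y \<in> succs G x - (W - A)" for x y
    proof -
      have y: "y \<notin> A" using VS_A x by blast
      then have "\<rho> y \<le> tup (slack W)" using regionD(4)[OF reg, of x y] x by blast
      moreover have "tup (slack W) \<le> tup (slack (W - A))" using WV by (intro slack_mono_tup) auto
      ultimately show ?thesis using not_A(1)[of y] y by auto
    qed
  qed
  let ?X = "{x \<in> V - W0. \<rho> x = Top}" and ?T = "W0 - W" and ?R = "REM - N"
  have X': "{x \<in> V - W0. \<rho>' x = Top} = ?X"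
  proof -
    have "\<rho>' x = \<rho> x" if "x \<notin> W0" for x using not_A(1) AW W0 that by blast
    then show ?thesis by auto
  qed
  have T: "W0 - (W - A) = ?T \<union> A" using AW W0 by auto
  have T_top: "\<rho> x = Top" if "x \<in> ?T" for x using act that by (simp add: active_def)
  have exit_top: "y \<in> ?T \<union> ?X" if "y \<notin> W" "y \<in> V" "\<rho> y = Top" for y using that by blast
  have domT: "dominion \<sigma>' ?T ?X"
    using act dominion_cong[of ?T \<sigma>' \<sigma>] not_A(2) AW by (auto simp: active_def)
  \<comment> \<open>Vertices of \<open>IRR\<close> are not lost, so the exits of the inner dominion
    are exactly these.\<close>
  have "{x \<in> V - REM. \<rho> x = Top} = ?T \<union> ?X \<union> RES"
    using T_top RES_top IRR_top RESW WV W0 vRES s(5,6) by auto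
  then have "dominion \<sigma> ?R (?T \<union> ?X \<union> RES)" using ret(1) by (simp add: active_def)
  then have domR: "dominion \<sigma>' ?R (?T \<union> ?X \<union> RES)"
    using dominion_cong[of ?R \<sigma>' \<sigma>] not_A(2) DOM' by auto
  have "dominion \<sigma>' (?T \<union> A) ?X"
  proof (rule dominion_resume[OF domT domR, where W = W and v = v and \<tau> = \<tau> and \<tau>' = \<tau>'])
    show "RES \<union> ?R \<subseteq> A" using DOMA DOM' by simp
    show "A \<subseteq> W" "W \<subseteq> V" using AW WV by auto
    show "W \<inter> (?T \<union> ?X) = {}" "?T \<inter> ?X = {}" using W0 by auto
    show "attracting G Square W RES {v} \<tau>" "v \<in> RES" "odd (P v)" using s(7,2) vRES by auto
    show "\<sigma>' x = Some (\<tau> x)" if "x \<in> RES - {v}" "x \<in> VS" for x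
      using \<tau> that not_A(2)[of x] DOM' by auto
    show "succs G x \<subseteq> RES \<union> ?T \<union> ?X" if x: "x \<in> RES - {v}" "x \<in> VD" for x
    proof
      fix y assume y: "y \<in> succs G x"
      have "succs G x \<inter> W \<subseteq> RES"
        using attr_cases(2)[of x G Square W "{w \<in> W. P v \<le> P w}" "{v}"] x owned_disj
        unfolding s(3) by auto
      then show "y \<in> RES \<union> ?T \<union> ?X"
        using y exit_top[of y] regionD(3)[OF reg, of x y] x RESW succs_sub by blast
    qed
    show "\<exists>u\<in>succs G v \<inter> (RES \<union> ?R). \<sigma>' v = Some u" if "v \<in> VS"
      using VS_v that in_DOM not_A(2)[of v] vRES unfolding DOM' by auto
    show "succs G v \<subseteq> RES \<union> ?R \<union> ?T \<union> ?X" if vD: "v \<in> VD"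
    proof
      fix y assume y: "y \<in> succs G v"
      show "y \<in> RES \<union> ?R \<union> ?T \<union> ?X"
      proof (cases "y \<in> W")
        case True
        then have "y \<in> DOM" using VD_v vD y in_DOM by blast
        then show ?thesis unfolding DOM' by blast
      next
        case False
        then show ?thesis using exit_top[of y] regionD(3)[OF reg s(1) vD y] y succs_sub by blast
      qed
    qed
    show "P v \<le> P x" if x: "x \<in> RES \<union> ?R" for x
    proof -
      have "x \<in> W" "x \<notin> IRR" using x RESW s(5,6) by auto
      then show ?thesis
        using attr.target[of x "{w \<in> W. P w < P v}" G Diamond W W] unfolding s(4) by force
    qed
    show "attracting G Square W A (RES \<union> ?R) \<tau>'" using \<tau>' DOM' by simp
    show "\<sigma>' x = Some (\<tau>' x)" if "x \<in> A - (RES \<union> ?R)" "x \<in> VS" for x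
      using that DOM' by (simp add: \<sigma>'_def record_moves_def)
    show "succs G x \<subseteq> A \<union> ?T \<union> ?X" if x: "x \<in> A - (RES \<union> ?R)" "x \<in> VD" for x
    proof
      fix y assume y: "y \<in> succs G x"
      have "succs G x \<inter> W \<subseteq> A"
        using attr_cases(2)[of x G Square W W DOM] x owned_disj DOM' unfolding A by auto
      then show "y \<in> A \<union> ?T \<union> ?X"
        using y exit_top[of y] regionD(3)[OF reg, of x y] x AW succs_sub by blast
    qed
  qed
  moreover have "\<forall>x\<in>?T \<union> A. \<rho>' x = Top"
    using A_top T_top not_A(1) by (metis DiffE Un_iff)
  ultimately show "active W0 (W - A) \<sigma>' \<rho>'"
    unfolding active_def T X' using reg' W0 by blast
qed

lemma inv_step:
  assumes "step G c s c'" "config_inv c"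
  shows "config_inv c'"
  using assms
proof cases
  case init
  have "region (\<lambda>w. Tuple (replicate len 0)) V"
    using succs_nonempty succs_sub by (auto simp: region_def Int_absorb2)
  then show ?thesis
    using init reachable_zero by (auto simp: legal_def active_def fresh_def)
next
  case (lift w W \<rho> fs \<sigma>)
  then obtain W0 where i: "reachable \<rho>" "legal \<sigma>" "active W0 W \<sigma> \<rho>" "stack fs W0 \<sigma> \<rho>" "fresh \<rho> W"
    using assms(2) by auto
  have W: "W \<subseteq> W0" "W0 \<subseteq> V" "region \<rho> W" using i(3) by (auto simp: active_def)
  have off: "lift G \<rho> w x = \<rho> x" if "x \<noteq> w" for x using that by (simp add: lift_eq)
  have "active W0 W \<sigma> (lift G \<rho> w)"
    using off lift(4) by (intro active_cong[OF i(3)]) metis+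
  moreover have "stack fs W0 \<sigma> (lift G \<rho> w)"
    using off lift(4) W(1) by (intro stack_cong[OF i(4)]) (metis subsetD)+
  moreover have "fresh (lift G \<rho> w) W"
    unfolding fresh_def
  proof (intro ballI impI)
    fix x assume x: "x \<in> W" "lift G \<rho> w x = Top"
    then have "x = w" using off[of x] lift(6) by metis
    moreover have "y = w" if "y \<in> W" "lift G \<rho> w y = Top" for y
      using off[of y] lift(6) that by metis
    ultimately show "just_lifted (lift G \<rho> w) x \<and> (\<forall>y\<in>W. lift G \<rho> w y = Top \<longrightarrow> y = x)"
      using just_lifted_lift[OF i(1) W(3) lift(4)] lift(6) x(2) by blast
  qed
  ultimately show ?thesis
    using lift i(2) reachable_lift[OF i(1), of w] W by auto
next
  case (leave W \<rho> fs \<sigma>)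
  then obtain W0 where i: "reachable \<rho>" "legal \<sigma>" "active W0 W \<sigma> \<rho>" "stack fs W0 \<sigma> \<rho>"
    using assms(2) by auto
  have "final \<rho> W" using leave(4,5) by (auto simp: final_def less_lift_iff)
  then show ?thesis using leave i inv_stack_returned[OF i(4)] by auto
next
  case (top v W \<rho> k u RES \<tau> IRR REM fs \<sigma>)
  then obtain W0 where i: "reachable \<rho>" "legal \<sigma>" "active W0 W \<sigma> \<rho>" "stack fs W0 \<sigma> \<rho>" "fresh \<rho> W"
    using assms(2) by auto
  let ?\<sigma> = "record_moves ((RES - {v}) \<inter> owned G Square) \<tau> (\<sigma>(v \<mapsto> u))"
  let ?\<rho> = "set_top (RES - {v}) \<rho>"
  have W: "W \<subseteq> W0" "region \<rho> W" "W \<subseteq> V" using i(3) by (auto simp: active_def)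
  have jl: "just_lifted \<rho> v" using i(5) top(4,5) by (auto simp: fresh_def)
  have uniq: "\<rho> w = Top \<longleftrightarrow> w = v" if "w \<in> W" for w using top(5) that by blast
  note k = top(6)
  have mx: "trunc (P v) (\<rho> u') \<le> trunc (P v) (\<rho> u)" if "u' \<in> succs G v \<inter> W" for u'
    using top(8) that unfolding k by blast
  note t = top_step[OF i(1,2) W(2) top(4) uniq jl top(7) mx top(9)[unfolded k] top(10)
      top(11)[unfolded k] top(12)]
  have RESW: "RES \<subseteq> W" using guarded_attractor_subset[OF top(4)] top(9) by simp
  have act: "active W0 W ?\<sigma> ?\<rho>"
    by (rule active_cong[OF i(3)])
      (use RESW top(4) in \<open>auto simp: set_top_def record_moves_def\<close>)
  have "stack fs W0 ?\<sigma> ?\<rho>"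
    by (rule stack_cong[OF i(4)])
      (use RESW W(1) top(4) in \<open>auto simp: set_top_def record_moves_def\<close>)
  then have "stack (Resume W RES REM # fs) REM ?\<sigma> ?\<rho>" using t(3) act by auto
  moreover have "active REM REM ?\<sigma> ?\<rho>"
    using t(4) regionD(1)[OF t(4)] by (simp add: active_def)
  ultimately show ?thesis
    using top(3) t by (auto simp: fresh_def)
next
  case (resume DOM RES REM \<rho> A W \<tau> fs \<sigma>)
  then obtain W0 N where i: "reachable \<rho>" "legal \<sigma>" "active REM N \<sigma> \<rho>" "final \<rho> N"
      "suspended W RES REM \<sigma> \<rho>" "active W0 W \<sigma> \<rho>" "stack fs W0 \<sigma> \<rho>"
    using assms(2) by auto
  let ?\<sigma> = "record_moves ((A - DOM) \<inter> owned G Square) \<tau> \<sigma>" and ?\<rho> = "set_top (A - DOM) \<rho>"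
  have r: "reachable ?\<rho>" "legal ?\<sigma>" "active W0 (W - A) ?\<sigma> ?\<rho>" "\<And>x. x \<in> W - A \<Longrightarrow> ?\<rho> x \<noteq> Top"
    using resume_step[OF i(1,2,5,6,3,4) resume(4,5,6)] by blast+
  have "DOM \<subseteq> W" using suspended_subset[OF i(5)] resume(4) by auto
  then have "A \<subseteq> W" unfolding resume(5) by (rule attractor_subset)
  then have "A \<subseteq> W0" using i(6) by (auto simp: active_def)
  then have "stack fs W0 ?\<sigma> ?\<rho>"
    by (intro stack_cong[OF i(7)]) (auto simp: set_top_def record_moves_def)
  then show ?thesis using resume(3) r by (auto simp: fresh_def)
next
  case (finish \<sigma>' \<rho> \<sigma>)
  then obtain W where i: "reachable \<rho>" "legal \<sigma>" "active V W \<sigma> \<rho>" "final \<rho> W"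
    using assms(2) by auto
  \<comment> \<open>The outermost activation keeps exactly the vertices that are not lost; its
    dominion has no exits since it was called with \<open>V\<close>.\<close>
  have W: "W = {v \<in> V. \<rho> v \<noteq> Top}" "V - W = {v \<in> V. \<rho> v = Top}"
    using i(3,4) by (auto simp: active_def final_def)
  have "dominion \<sigma> {v \<in> V. \<rho> v = Top} {}"
    using i(3) W(2) by (simp add: active_def)
  then have S: "winning_strategy_on G Square {v \<in> V. \<rho> v = Top} \<sigma>"
    by (rule dominion_winning) (use i(2) in \<open>auto simp: legal_def\<close>)
  have "sat_at \<rho> x (\<rho> x)" if "x \<in> {v \<in> V. \<rho> v \<noteq> Top}" for x
    using i(1,4) up_le_iff[of x "\<rho> x" \<rho>] that unfolding W(1)[symmetric]
    by (auto simp: final_def reachable_def W(1))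
  then have D: "winning_strategy_on G Diamond {v \<in> V. \<rho> v \<noteq> Top} \<sigma>'"
    by (rule progress_winning) (use finish in blast)+
  show ?thesis using finish(3) S D winning_regions[OF D S] by simp
qed

lemma inv_steps: "steps G Start t c \<Longrightarrow> config_inv c"
  by (induction rule: steps.induct) (use inv_step in auto)

text \<open>Every open choice can be made: a region offers a successor in \<open>W\<close>, rankings
  give attracting strategies, and \<open>fresh\<close> the uniqueness of the lost vertex.\<close>

lemma inv_progress:
  assumes "config_inv (Running fs \<sigma> \<rho>)"
  shows "\<exists>s c'. step G (Running fs \<sigma> \<rho>) s c'"
proof (cases fs)
  case Nil
  have "\<exists>u. v \<in> VD \<longrightarrow> u \<in> succs G v \<and> (\<forall>w\<in>succs G v. \<rho> u \<le> \<rho> w)" for v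
  proof (cases "v \<in> VD")
    case True
    then have ne: "succs G v \<noteq> {}" using succs_nonempty ownedD by blast
    then have "Min (\<rho> ` succs G v) \<in> \<rho> ` succs G v" by (intro Min_in) auto
    then obtain u where "u \<in> succs G v" "\<rho> u = Min (\<rho> ` succs G v)" by auto
    then show ?thesis by auto
  qed simp
  then obtain f where f: "\<And>v. v \<in> VD \<Longrightarrow> f v \<in> succs G v \<and> (\<forall>w\<in>succs G v. \<rho> (f v) \<le> \<rho> w)"
    by metis
  let ?\<sigma> = "\<lambda>v. if v \<in> VD \<and> \<rho> v \<noteq> Top then Some (f v) else None"
  have "dom ?\<sigma> = {v \<in> VD. \<rho> v \<noteq> Top}" by (auto split: if_splits)
  moreover have "\<forall>v u. ?\<sigma> v = Some u \<longrightarrow> u \<in> succs G v \<and> (\<forall>w\<in>succs G v. \<rho> u \<le> \<rho> w)"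
    using f by (auto split: if_splits)
  ultimately show ?thesis unfolding Nil by (blast intro: step.finish)
next
  case (Cons F fs')
  show ?thesis
  proof (cases F)
    case (Within W)
    then obtain W0 where i: "active W0 W \<sigma> \<rho>" "fresh \<rho> W" using assms Cons by auto
    have reg: "region \<rho> W" and WV: "W \<subseteq> V" using i regionD(1) by (auto simp: active_def)
    consider "\<forall>w\<in>W. \<rho> w \<noteq> Top" "\<forall>w\<in>W. \<not> \<rho> < lift G \<rho> w"
      | w where "\<forall>w\<in>W. \<rho> w \<noteq> Top" "w \<in> W" "\<rho> < lift G \<rho> w"
      | v where "v \<in> W" "\<rho> v = Top" by blast
    then show ?thesis
    proof cases
      case 1 then show ?thesis unfolding Cons Within by (blast intro: step.leave)
    next
      case 2 then show ?thesis unfolding Cons Within by (blast intro: step.lift)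
    next
      case 3
      let ?Q = "(\<lambda>u. trunc (P v) (\<rho> u)) ` (succs G v \<inter> W)"
      have "Max ?Q \<in> ?Q" using regionD(2)[OF reg 3(1)] by (intro Max_in) auto
      then obtain u where u: "u \<in> succs G v \<inter> W" "trunc (P v) (\<rho> u) = Max ?Q" by auto
      have mx: "\<forall>u'\<in>succs G v \<inter> W. trunc (P v) (\<rho> u') \<le> trunc (P v) (\<rho> u)"
        unfolding u(2) by (auto intro!: Max_ge)
      have uniq: "\<forall>w\<in>W. \<rho> w = Top \<longleftrightarrow> w = v" using i(2) 3 by (auto simp: fresh_def)
      obtain \<tau> where "attracting G Square W (guarded_attractor G (P v) W {v}) {v} \<tau>"
        using attracting_exists[of W "{w \<in> W. P v \<le> P w}" "{v}" Square] WV 3(1) by auto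
      then show ?thesis
        unfolding Cons Within using step.top[OF 3(1) uniq HOL.refl u(1) mx HOL.refl _ HOL.refl HOL.refl] by blast
    qed
  next
    case (Resume W RES REM)
    then obtain W0 where i: "suspended W RES REM \<sigma> \<rho>" "active W0 W \<sigma> \<rho>"
      using assms Cons by auto
    have "RES \<union> {w \<in> REM. \<rho> w = Top} \<subseteq> W"
      using suspended_subset[OF i(1)] by auto
    moreover have "W \<subseteq> V" using i(2) regionD(1) by (auto simp: active_def)
    ultimately obtain \<tau> where "attracting G Square W
        (attractor G Square W (RES \<union> {w \<in> REM. \<rho> w = Top})) (RES \<union> {w \<in> REM. \<rho> w = Top}) \<tau>"
      using attracting_exists[of W W _ Square] by blast
    then show ?thesis unfolding Cons Resume using step.resume[OF HOL.refl HOL.refl] by blast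
  qed
qed

lemma solve_is_correct: "solve_correct G"
  unfolding solve_correct_def
proof (intro allI impI, elim conjE)
  fix t c assume st: "steps G Start t c" and stuck: "\<not> (\<exists>s c'. step G c s c')"
  have i: "config_inv c" using inv_steps[OF st] .
  show "\<exists>\<sigma>\<^sub>D \<sigma>\<^sub>S. c = Done (winning_region G Diamond, \<sigma>\<^sub>D) (winning_region G Square, \<sigma>\<^sub>S) \<and>
      winning_strategy_on G Diamond (winning_region G Diamond) \<sigma>\<^sub>D \<and>
      winning_strategy_on G Square (winning_region G Square) \<sigma>\<^sub>S"
  proof (cases c)
    case Start
    then show ?thesis using stuck step.init by blast
  next
    case (Running fs \<sigma> \<rho>)
    then show ?thesis using stuck inv_progress i by blast
  next
    case (Done a b)
    then show ?thesis using i by (cases a; cases b) auto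
  qed
qed

section \<open>Running time\<close>

text \<open>A bound on how often a vertex of value \<open>m\<close> can still be lifted.\<close>

definition height :: "measure \<Rightarrow> nat" where
  "height m = card {m' \<in> M. m < m'}"

lemma height_antimono: "m \<le> m' \<Longrightarrow> height m' \<le> height m"
  unfolding height_def by (rule card_mono) auto

lemma height_less:
  assumes "m < m'" "m' \<in> M"
  shows "height m' < height m"
proof -
  have "{x \<in> M. m' < x} \<subset> {x \<in> M. m < x}" using assms by auto
  then show ?thesis unfolding height_def by (rule psubset_card_mono[rotated]) auto
qed

lemma height_le:
  assumes "m \<in> M"
  shows "height m \<le> (\<Prod>i<len. (if odd i then cap i else 0) + 1)"
proof -
  have "{m' \<in> M. m < m'} \<subset> M" using assms by auto
  then have "height m < card M" unfolding height_def by (rule psubset_card_mono[rotated]) auto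
  then show ?thesis using card_M_le by linarith
qed

text \<open>Steps other than lifts still owed by a frame: one \<open>leave\<close> for
  \<open>Within\<close>, a \<open>resume\<close> and a later \<open>leave\<close> for
  \<open>Resume\<close>, and three more for a lost vertex in \<open>W\<close>.\<close>

fun weight :: "('v \<Rightarrow> measure) \<Rightarrow> 'v frame \<Rightarrow> nat" where
  "weight \<rho> (Within W) = 1 + 3 * card {w \<in> W. \<rho> w = Top}"
| "weight \<rho> (Resume W RES REM) = 2"

definition live :: "('v \<Rightarrow> measure) \<Rightarrow> nat" where
  "live \<rho> = card {w \<in> V. odd (P w) \<and> \<rho> w \<noteq> Top}"

text \<open>
  Every vertex that is lifted to \<open>Top\<close> has an odd priority and triggers one \<open>top\<close>, one \<open>resume\<close> and one
  \<open>leave\<close> step; hence the factor \<open>3\<close>.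
\<close>

fun potential :: "('v \<Rightarrow> nat) \<Rightarrow> nat \<Rightarrow> 'v config \<Rightarrow> nat" where
  "potential a b Start = (\<Sum>w\<in>V. a w * height (Tuple (replicate len 0))) +
     b * (3 * card {w \<in> V. odd (P w)} + 3)"
| "potential a b (Running fs \<sigma> \<rho>) = (\<Sum>w\<in>V. a w * height (\<rho> w)) +
     b * (3 * live \<rho> + sum_list (map (weight \<rho>) fs) + 1)"
| "potential a b (Done x y) = 0"

lemma stack_weight: "stack fs W0 \<sigma> \<rho> \<Longrightarrow> sum_list (map (weight \<rho>') fs) = 2 * length fs"
  by (induction fs W0 \<sigma> \<rho> rule: stack.induct) auto

text \<open>Raising \<rho> raises neither heights nor the number of live vertices, so the drop of
  the frame weights alone pays for the step.\<close>

lemma potential_scan_mono: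
  assumes "\<And>x. \<rho> x \<le> \<rho>' x" "sum_list (map (weight \<rho>') fs') < sum_list (map (weight \<rho>) fs)"
  shows "potential a b (Running fs' \<sigma>' \<rho>') + b \<le> potential a b (Running fs \<sigma> \<rho>)"
proof -
  have "(\<Sum>w\<in>V. a w * height (\<rho>' w)) \<le> (\<Sum>w\<in>V. a w * height (\<rho> w))"
    using assms(1) by (intro sum_mono mult_le_mono2 height_antimono)
  moreover have "live \<rho>' \<le> live \<rho>"
    unfolding live_def
  proof (rule card_mono)
    show "{w \<in> V. odd (P w) \<and> \<rho>' w \<noteq> Top} \<subseteq> {w \<in> V. odd (P w) \<and> \<rho> w \<noteq> Top}"
      using assms(1) by (auto; metis measure_le_simps(2))
  qed simp
  then have "b * (3 * live \<rho>' + sum_list (map (weight \<rho>') fs') + 1) + b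
      \<le> b * (3 * live \<rho> + sum_list (map (weight \<rho>) fs) + 1)"
    using assms(2) unfolding add_mult_distrib2[symmetric] mult_Suc_right[symmetric] add.commute[of _ b]
    by (intro mult_le_mono2) linarith
  ultimately show ?thesis by simp
qed

text \<open>The prices \<open>a\<close> and \<open>b\<close> are left open: unit prices give
  termination, the actual costs give the running time.\<close>

lemma potential_step:
  assumes "step G c s c'" "config_inv c"
  shows "(\<exists>w\<in>V. s = lift_cost G w \<and> potential a b c' + a w \<le> potential a b c) \<or>
    s = scan_cost G \<and> potential a b c' + b \<le> potential a b c"
  using assms
proof cases
  case init
  then show ?thesis by (simp add: live_def algebra_simps)
next
  case (lift w W \<rho> fs \<sigma>)
  let ?\<rho> = "lift G \<rho> w"
  obtain W0 where i: "reachable \<rho>" "active W0 W \<sigma> \<rho>" "stack fs W0 \<sigma> \<rho>"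
    using assms(2) lift by auto
  have WV: "W \<subseteq> V" and w: "w \<in> V" using i(2) lift(4) by (auto simp: active_def)
  have "config_inv c'" using inv_step[OF assms] .
  then have i': "reachable ?\<rho>" "fresh ?\<rho> W" using lift(3) by auto
  have off: "?\<rho> x = \<rho> x" if "x \<noteq> w" for x using that by (simp add: lift_eq)
  have "\<not> up \<rho> w \<le> \<rho> w" using lift(5) by (simp add: less_lift_iff)
  then have "\<rho> w < ?\<rho> w" by (auto simp: lift_eq max_def)
  then have h: "height (?\<rho> w) + 1 \<le> height (\<rho> w)"
    using height_less i'(1) by (auto simp: reachable_def Suc_le_eq)
  have "(\<Sum>x\<in>V. a x * height (?\<rho> x)) = a w * height (?\<rho> w) + (\<Sum>x\<in>V - {w}. a x * height (\<rho> x))"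
    using w by (subst sum.remove[of _ w]) (auto intro!: sum.cong simp: off)
  moreover have "(\<Sum>x\<in>V. a x * height (\<rho> x)) = a w * height (\<rho> w) + (\<Sum>x\<in>V - {w}. a x * height (\<rho> x))"
    using w by (subst sum.remove[of _ w]) auto
  moreover have "a w * (height (?\<rho> w) + 1) \<le> a w * height (\<rho> w)" using h by (rule mult_le_mono2)
  ultimately have sum: "(\<Sum>x\<in>V. a x * height (?\<rho> x)) + a w \<le> (\<Sum>x\<in>V. a x * height (\<rho> x))"
    by (simp add: algebra_simps)
  have "\<rho> w \<noteq> Top" using lift(4,6) by blast
  have "{x \<in> W. \<rho> x = Top} = {}" using lift(6) by auto
  then have noTop: "card {x \<in> W. \<rho> x = Top} = 0" by (simp only: card.empty)
  \<comment> \<open>A lift to \<open>Top\<close> moves one vertex from \<open>live\<close> to the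
    weight of the topmost frame.\<close>
  have "live ?\<rho> + card {x \<in> W. ?\<rho> x = Top} = live \<rho>"
  proof (cases "?\<rho> w = Top")
    case True
    then have "{x \<in> W. ?\<rho> x = Top} = {w}" using lift(4,6) off by force
    moreover have "odd (P w)"
      using i'(2) True lift(4) by (auto simp: fresh_def just_lifted_def)
    then have "{x \<in> V. odd (P x) \<and> \<rho> x \<noteq> Top} = insert w {x \<in> V. odd (P x) \<and> ?\<rho> x \<noteq> Top}"
      using off w \<open>\<rho> w \<noteq> Top\<close> True by force
    ultimately show ?thesis using True by (simp add: live_def)
  next
    case False
    then have "{x \<in> W. ?\<rho> x = Top} = {}" using lift(6) off by force
    then have "card {x \<in> W. ?\<rho> x = Top} = 0" by (simp only: card.empty)
    moreover have "{x \<in> V. odd (P x) \<and> \<rho> x \<noteq> Top} = {x \<in> V. odd (P x) \<and> ?\<rho> x \<noteq> Top}"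
      using off \<open>\<rho> w \<noteq> Top\<close> False by metis
    ultimately show ?thesis by (simp add: live_def)
  qed
  then have "3 * live ?\<rho> + sum_list (map (weight ?\<rho>) (Within W # fs)) =
      3 * live \<rho> + sum_list (map (weight \<rho>) (Within W # fs))"
    using noTop stack_weight[OF i(3), of ?\<rho>] stack_weight[OF i(3), of \<rho>] by simp
  then have "potential a b c' + a w \<le> potential a b c" using sum unfolding lift(1,3) by simp
  then show ?thesis using lift(2) w by blast
next
  case (leave W \<rho> fs \<sigma>)
  then show ?thesis using potential_scan_mono[of \<rho> \<rho> fs "Within W # fs" a b \<sigma> \<sigma>] by simp
next
  case (top v W \<rho> k u RES \<tau> IRR REM fs \<sigma>)
  let ?\<rho> = "set_top (RES - {v}) \<rho>"
  obtain W0 where i: "stack fs W0 \<sigma> \<rho>" using assms(2) top by auto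
  have "v \<in> RES" unfolding top(9) by (rule guarded_attractor_self)
  then have "{w \<in> REM. ?\<rho> w = Top} = {}" using top(5,12) by (auto simp: set_top_def)
  then have "card {w \<in> REM. ?\<rho> w = Top} = 0" by (simp only: card.empty)
  moreover have "{w \<in> W. \<rho> w = Top} = {v}" using top(4,5) by auto
  ultimately have "sum_list (map (weight ?\<rho>) (Within REM # Resume W RES REM # fs))
      < sum_list (map (weight \<rho>) (Within W # fs))"
    using stack_weight[OF i, of ?\<rho>] stack_weight[OF i, of \<rho>] by simp
  then show ?thesis
    unfolding top(1-3) by (intro disjI2 conjI HOL.refl potential_scan_mono) (auto simp: set_top_def)
next
  case (resume DOM RES REM \<rho> A W \<tau> fs \<sigma>)
  then obtain W0 N where i: "reachable \<rho>" "legal \<sigma>" "active REM N \<sigma> \<rho>" "final \<rho> N"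
      "suspended W RES REM \<sigma> \<rho>" "active W0 W \<sigma> \<rho>" "stack fs W0 \<sigma> \<rho>"
    using assms(2) by auto
  let ?\<rho> = "set_top (A - DOM) \<rho>"
  have "{w \<in> W - A. ?\<rho> w = Top} = {}"
    using resume_step(4)[OF i(1,2,5,6,3,4) resume(4,5,6)] by blast
  then have "card {w \<in> W - A. ?\<rho> w = Top} = 0" by (simp only: card.empty)
  then have "sum_list (map (weight ?\<rho>) (Within (W - A) # fs))
      < sum_list (map (weight \<rho>) (Resume W RES REM # fs))"
    using stack_weight[OF i(7), of ?\<rho>] stack_weight[OF i(7), of \<rho>] by simp
  then show ?thesis
    unfolding resume(1-3) by (intro disjI2 conjI HOL.refl potential_scan_mono) (auto simp: set_top_def)
next
  case finish
  then show ?thesis by simp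
qed

lemma solve_is_terminating: "solve_terminates G"
  unfolding solve_terminates_def
proof
  assume "\<exists>cs. cs 0 = Start \<and> (\<forall>i::nat. \<exists>s. step G (cs i) s (cs (Suc i)))"
  then obtain cs where cs: "cs 0 = Start" "\<And>i::nat. \<exists>s. step G (cs i) s (cs (Suc i))" by blast
  have config_inv: "config_inv (cs i)" for i
  proof (induction i)
    case (Suc i)
    then show ?case using cs(2)[of i] inv_step by blast
  qed (simp add: cs(1))
  have "potential (\<lambda>_. 1) 1 (cs (Suc i)) < potential (\<lambda>_. 1) 1 (cs i)" for i
    using cs(2)[of i] potential_step[OF _ config_inv, of i _ _ "\<lambda>_. 1" 1] by fastforce
  then show False
    using wf_iff_no_infinite_down_chain[of "measure (potential (\<lambda>_. 1) 1)"] by (auto simp: in_measure)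
qed

section \<open>Total cost of an execution\<close>

lemma steps_potential:
  assumes "steps G Start t c"
  shows "t + potential (lift_cost G) (scan_cost G) c \<le> potential (lift_cost G) (scan_cost G) Start"
  using assms
proof induction
  case (step t c' s c'')
  then show ?case
    using potential_step[OF step.hyps(2) inv_steps[OF step.hyps(1)], of "lift_cost G" "scan_cost G"]
    by auto
qed simp

text \<open>Each edge is charged once at its source and once at its target.\<close>

lemma sum_lift_cost: "(\<Sum>w\<in>V. lift_cost G w) = num_prios G * (2 * card (edges G))"
proof -
  have E: "edges G \<subseteq> V \<times> V" using pg by (simp add: parity_game_def)
  have "edges G = Sigma V (succs G)" using E by (auto simp: succs_def)
  then have 1: "card (edges G) = (\<Sum>w\<in>V. card (succs G w))" by (simp add: card_SigmaI)
  have "preds G w \<subseteq> V" for w using E by (auto simp: preds_def)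
  then have fin: "finite (preds G w)" for w by (rule finite_subset) simp
  have "(edges G)\<inverse> = Sigma V (preds G)" using E by (auto simp: preds_def)
  moreover have "card ((edges G)\<inverse>) = card (edges G)" by (rule card_inverse)
  ultimately have 2: "card (edges G) = (\<Sum>w\<in>V. card (preds G w))" using fin by (simp add: card_SigmaI)
  show ?thesis
    unfolding lift_cost_def sum_distrib_left[symmetric] sum.distrib using 1 2 by simp
qed

lemma time_le:
  assumes "steps G Start t c"
  shows "t \<le> num_prios G * card (edges G) *
    (2 * (\<Prod>i<len. (if odd i then cap i else 0) + 1) + (3 * card {w \<in> V. odd (P w)} + 3))"
proof -
  have "t \<le> potential (lift_cost G) (scan_cost G) Start" using steps_potential[OF assms] by simp
  also have "\<dots> = (\<Sum>w\<in>V. lift_cost G w) * height (Tuple (replicate len 0)) +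
      scan_cost G * (3 * card {w \<in> V. odd (P w)} + 3)"
    by (simp add: sum_distrib_right)
  also have "\<dots> \<le> (\<Sum>w\<in>V. lift_cost G w) * (\<Prod>i<len. (if odd i then cap i else 0) + 1) +
      scan_cost G * (3 * card {w \<in> V. odd (P w)} + 3)"
    by (intro add_right_mono mult_le_mono2 height_le zero_in)
  finally show ?thesis
    unfolding sum_lift_cost scan_cost_def by (simp add: algebra_simps)
qed

text \<open>The number of tuples is a product over the odd priorities. Padded to \<open>h\<close>
  factors, the factors add up to the number of odd vertices plus \<open>h\<close>, which is at most
  \<open>n\<close> because each of at least \<open>h\<close> even priorities has a vertex; then the
  inequality of the means applies. For \<open>h > 0\<close> the second bound goes through
  \<open>n \<le> B\<close>.\<close>

lemma tuples_and_odd_le: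
  fixes n h :: nat
  defines "n \<equiv> card V" and "h \<equiv> num_prios G div 2"
  assumes few_odd: "card {k \<in> P ` V. odd k} \<le> card {k \<in> P ` V. even k}"
  defines "B \<equiv> (real n / real h) ^ h"
  shows "real (\<Prod>i<len. (if odd i then cap i else 0) + 1) \<le> B" "real (card {w \<in> V. odd (P w)} + 1) \<le> B"
proof -
  let ?K = "\<Prod>i<len. (if odd i then cap i else 0) + 1"
  define Od where "Od = {k \<in> P ` V. odd k}"
  define Ev where "Ev = {k \<in> P ` V. even k}"
  define odds where "odds = card {w \<in> V. odd (P w)}"
  have finO: "finite Od" "finite Ev" by (auto simp: Od_def Ev_def)
  have "P ` V = Od \<union> Ev" "Od \<inter> Ev = {}" by (auto simp: Od_def Ev_def)
  then have d: "num_prios G = card Od + card Ev"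
    using card_Un_disjoint finO unfolding num_prios_def by metis
  have OE: "card Od \<le> card Ev" using few_odd by (simp add: Od_def Ev_def)
  \<comment> \<open>Of two numbers with sum \<open>d\<close>, the smaller is at most
    \<open>d div 2\<close> and the larger at least that.\<close>
  then have hO: "card Od \<le> h" and hE: "h \<le> card Ev" unfolding h_def d by linarith+
  have "V = {w \<in> V. odd (P w)} \<union> {w \<in> V. even (P w)}" by auto
  then have n: "n = odds + card {w \<in> V. even (P w)}"
    unfolding n_def odds_def by (subst card_Un_disjoint[symmetric]) auto
  have "Ev = P ` {w \<in> V. even (P w)}" by (auto simp: Ev_def)
  then have "card Ev \<le> card {w \<in> V. even (P w)}" by (simp add: card_image_le)
  then have odds_h: "odds + h \<le> n" using n hE by linarith
  have Olen: "Od \<subseteq> {..<len}" using prio_less_dim by (auto simp: Od_def)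
  have K: "?K = (\<Prod>i\<in>Od. cap i + 1)"
  proof (rule prod.mono_neutral_cong_right)
    show "\<forall>i\<in>{..<len} - Od. (if odd i then cap i else 0) + 1 = 1"
      by (auto simp: Od_def cap_def)
  qed (use Olen in \<open>auto simp: Od_def\<close>)
  have "{w \<in> V. odd (P w)} = (\<Union>i\<in>Od. {w \<in> V. P w = i})" by (auto simp: Od_def)
  then have odds: "odds = (\<Sum>i\<in>Od. cap i)"
    unfolding odds_def cap_def using finO(1) by (simp only:) (rule card_UN_disjoint, auto)
  have "real ?K \<le> B \<and> real (odds + 1) \<le> B"
  proof (cases "h = 0")
    \<comment> \<open>There are no odd priorities, so the product is empty; \<open>B\<close> is 1,
      being a zeroth power.\<close>
    case True
    then have "Od = {}" using hO finO by simp
    then show ?thesis using True K odds by (simp add: B_def)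
  next
    case False
    \<comment> \<open>Indices from \<open>len\<close> on serve as dummies with factor 1, so that
      exactly \<open>h\<close> factors enter the mean.\<close>
    define S where "S = Od \<union> {len..<len + (h - card Od)}"
    define x where "x i = (if i \<in> Od then real (cap i + 1) else 1)" for i
    have disj: "Od \<inter> {len..<len + (h - card Od)} = {}" using Olen by auto
    have finS: "finite S" using finO by (simp add: S_def)
    have cardS: "card S = h" using disj finO hO by (simp add: S_def card_Un_disjoint)
    have "(\<Prod>i\<in>S. x i) = (\<Prod>i\<in>Od. x i) * (\<Prod>i\<in>{len..<len + (h - card Od)}. x i)"
      unfolding S_def using disj finO by (intro prod.union_disjoint) auto
    also have "(\<Prod>i\<in>{len..<len + (h - card Od)}. x i) = 1"
      using disj by (intro prod.neutral) (auto simp: x_def)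
    finally have pS: "(\<Prod>i\<in>S. x i) = real ?K" unfolding K by (simp add: x_def)
    have "(\<Sum>i\<in>S. x i) = (\<Sum>i\<in>Od. x i) + (\<Sum>i\<in>{len..<len + (h - card Od)}. x i)"
      unfolding S_def using disj finO by (intro sum.union_disjoint) auto
    also have "(\<Sum>i\<in>{len..<len + (h - card Od)}. x i) = (\<Sum>i\<in>{len..<len + (h - card Od)}. 1)"
      using disj by (intro sum.cong) (auto simp: x_def)
    also have "(\<Sum>i\<in>Od. x i) = real (odds + card Od)"
      unfolding odds by (simp add: x_def sum.distrib)
    finally have sS: "(\<Sum>i\<in>S. x i) = real (odds + h)" using hO by simp
    have "S \<noteq> {}" using cardS False by auto
    then have "real ?K powr (1 / h) \<le> (\<Sum>i\<in>S. x i / real h)"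
      using arith_geom_mean[OF finS, of x] unfolding cardS pS by (auto simp: x_def)
    also have "\<dots> = real (odds + h) / real h" unfolding sum_divide_distrib[symmetric] sS ..
    also have "\<dots> \<le> real n / real h" using odds_h by (intro divide_right_mono) linarith+
    finally have "(real ?K powr (1 / h)) ^ h \<le> B" unfolding B_def by (intro power_mono) auto
    moreover have "0 < real ?K" by (simp add: prod_pos)
    then have "(real ?K powr (1 / h)) ^ h = real ?K"
      using False by (subst powr_realpow[symmetric]) (simp_all add: powr_powr del: of_nat_prod)
    ultimately have 1: "real ?K \<le> B" by linarith
    have "2 * h \<le> n"
    proof -
      have "2 * h \<le> card (P ` V)" by (simp add: h_def num_prios_def)
      also have "\<dots> \<le> n" unfolding n_def by (rule card_image_le) simp
      finally show ?thesis .
    qed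
    then have q: "2 \<le> real n / real h" using False by (simp add: le_divide_eq)
    obtain h' where h': "h = Suc h'" using False by (cases h) auto
    \<comment> \<open>Together with \<open>n / h \<ge> 2\<close> this gives
      \<open>n = (n / h) * h \<le> (n / h) ^ h\<close>.\<close>
    have "h \<le> 2 ^ h'" unfolding h' by (simp add: Suc_leI)
    then have "real h \<le> 2 ^ h'" using of_nat_mono by fastforce
    also have "\<dots> \<le> (real n / real h) ^ h'" using q by (intro power_mono) auto
    finally have "real n / real h * real h \<le> B"
      unfolding B_def h' power_Suc using q h' by (intro mult_left_mono) auto
    then have "real n \<le> B" using False by simp
    moreover have "odds + 1 \<le> n" using odds_h False by linarith
    ultimately show ?thesis using 1 by linarith
  qed
  then show "real ?K \<le> B" "real (card {w \<in> V. odd (P w)} + 1) \<le> B"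
    by (simp_all add: odds_def)
qed

text \<open>The constant 5 is 2 for the two directions in which a lift scans edges, plus 3 for the
  scanning steps per odd vertex, the fixed number of remaining ones being absorbed by counting one
  odd vertex more.\<close>

lemma solve_time:
  assumes "card {k \<in> P ` V. odd k} \<le> card {k \<in> P ` V. even k}"
  shows "solve_time_le G (5 * (real (num_prios G) * real (card (edges G)) *
    (real (card V) / real (num_prios G div 2)) ^ (num_prios G div 2)))"
  unfolding solve_time_le_def
proof (intro allI impI)
  fix t c assume "steps G Start t c"
  let ?K = "\<Prod>i<len. (if odd i then cap i else 0) + 1" and ?o = "card {w \<in> V. odd (P w)}"
    and ?B = "(real (card V) / real (num_prios G div 2)) ^ (num_prios G div 2)"
    and ?dm = "num_prios G * card (edges G)"
  have "real t \<le> real (?dm * (2 * ?K + (3 * ?o + 3)))"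
    using time_le[OF \<open>steps G Start t c\<close>] of_nat_mono by blast
  also have "\<dots> = real ?dm * (2 * real ?K + 3 * real (?o + 1))" by (simp add: algebra_simps)
  also have "\<dots> \<le> real ?dm * (2 * ?B + 3 * ?B)"
    using tuples_and_odd_le[OF assms] by (intro mult_left_mono add_mono) auto
  finally show "real t \<le> 5 * (real (num_prios G) * real (card (edges G)) * ?B)"
    by (simp add: algebra_simps)
qed

end

theorem theorem5:
  shows
    "(\<forall>G :: 'v game. parity_game G \<longrightarrow> solve_terminates G \<and> solve_correct G) \<and>
     (\<exists>C :: real. \<forall>(G :: 'v game) n m d.
        parity_game G \<longrightarrow> n = card (verts G) \<longrightarrow> m = card (edges G) \<longrightarrow> d = num_prios G \<longrightarrow>
        card {k \<in> prio G ` verts G. odd k} \<le> card {k \<in> prio G ` verts G. even k} \<longrightarrow>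
        solve_time_le G
          (C * (real d * real m * (real n / real (d div 2)) ^ (d div 2))))"
proof (intro conjI)
  show "\<forall>G :: 'v game. parity_game G \<longrightarrow> solve_terminates G \<and> solve_correct G"
    using parity.solve_is_terminating parity.solve_is_correct parity.intro by blast
  show "\<exists>C :: real. \<forall>(G :: 'v game) n m d.
      parity_game G \<longrightarrow> n = card (verts G) \<longrightarrow> m = card (edges G) \<longrightarrow> d = num_prios G \<longrightarrow>
      card {k \<in> prio G ` verts G. odd k} \<le> card {k \<in> prio G ` verts G. even k} \<longrightarrow>
      solve_time_le G (C * (real d * real m * (real n / real (d div 2)) ^ (d div 2)))"
    using parity.solve_time[OF parity.intro] by blast
qed

end
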